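(* Let $\omega>0$, $\alpha\in\mathbb{R}$ with $\alpha\neq 0$, and let $\varepsilon$ be a small real parameter, $|\varepsilon|\ll 1$. Consider the nonlinear equation $$x''+\bigl(\omega^2+\varepsilon\cos(\omega t)\bigr)x+\varepsilon\alpha x^3=\varepsilon\sum_{n=1}^{\infty}\bigl(a_n\cos(n\omega t)+b_n\sin(n\omega t)\bigr),$$ where the series on the right is the Fourier series of a real function of period $2\pi/\omega$ with zero average satisfying the Dirichlet conditions, and the Fourier coefficients $a_1$ and $b_1$ are not both zero. Then this equation admits an approximate $T$-periodic solution with $T=2\pi/\omega$. The zeroth-order approximate solution is $$x(t)=\frac{\omega x_0^*\cos(\omega t)+y_0^*\sin(\omega t)}{\omega}+O(\varepsilon),$$ where $$(x_0^*,y_0^* )=\left(\sqrt[3]{\frac{4a_1^3}{3\alpha(a_1^2+b_1^2)}},\ \sqrt[3]{\frac{4b_1^3\omega^3}{3\alpha(a_1^2+b_1^2)}}\right).$$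
   Context: A periodic function satisfies the Dirichlet conditions if on one period it is bounded, has at most finitely many discontinuities (all of them jump discontinuities), and has at most finitely many local maxima and minima; in particular its Fourier series converges. Cube roots are real cube roots. "Approximate solution" is meant in the sense of the formal two-timing method: with fast time $T_0=t$ and slow time $T_1=\varepsilon t$, one writes $x(t)=x_0(T_0,T_1)+\varepsilon x_1(T_0,T_1)+\varepsilon^2x_2(T_0,T_1)+\cdots$, inserts this in the equation and neglects terms of order $\varepsilon^2$; the order-zero equation gives $x_0=A(T_1)\cos(\omega T_0+\psi(T_1))$, and the amplitude $A$ and phase $\psi$ are governed by the requirement that the order-one equation for $x_1$ contain no secular (resonant) terms. The approximate $T$-periodic solution corresponds to an equilibrium of the resulting equations for $(A,\psi)$, and the zeroth-order approximation is the corresponding $x_0$. *)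

theory Defs
  imports "HOL-Analysis.Analysis"
begin

text \<open>
  Dirichlet conditions for a function of period \<open>T\<close>.  At a discontinuity both one-sided limits
  are required to exist; they are not required to differ, so removable discontinuities are also
  allowed.  Local extrema are meant in the weak sense, and a plateau counts as a single extremum:
  the points of local maximum (minimum) within a period form finitely many connected components.
  Demanding finitely many such points instead would exclude square waves.
\<close>

definition local_max_point :: "(real \<Rightarrow> real) \<Rightarrow> real \<Rightarrow> bool" where
  "local_max_point f t \<longleftrightarrow> (\<forall>\<^sub>F s in nhds t. f s \<le> f t)"

definition local_min_point :: "(real \<Rightarrow> real) \<Rightarrow> real \<Rightarrow> bool" where
  "local_min_point f t \<longleftrightarrow> (\<forall>\<^sub>F s in nhds t. f t \<le> f s)"

definition dirichlet_conditions :: "real \<Rightarrow> (real \<Rightarrow> real) \<Rightarrow> bool" where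
  "dirichlet_conditions T f \<longleftrightarrow>
     bounded (f ` {0..<T}) \<and>
     finite {t \<in> {0..<T}. \<not> isCont f t} \<and>
     (\<forall>t\<in>{0..<T}. \<not> isCont f t \<longrightarrow>
        (\<exists>l. (f \<longlongrightarrow> l) (at_left t)) \<and> (\<exists>r. (f \<longlongrightarrow> r) (at_right t))) \<and>
     finite (components {t \<in> {0..<T}. local_max_point f t}) \<and>
     finite (components {t \<in> {0..<T}. local_min_point f t})"

text \<open>Real Fourier coefficients with respect to the period \<open>2 * pi / \<omega>\<close>.\<close>

definition fourier_cos_coeff :: "real \<Rightarrow> (real \<Rightarrow> real) \<Rightarrow> nat \<Rightarrow> real" where
  "fourier_cos_coeff \<omega> f n =
     \<omega> / pi * integral {0..2 * pi / \<omega>} (\<lambda>t. f t * cos (real n * \<omega> * t))"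

definition fourier_sin_coeff :: "real \<Rightarrow> (real \<Rightarrow> real) \<Rightarrow> nat \<Rightarrow> real" where
  "fourier_sin_coeff \<omega> f n =
     \<omega> / pi * integral {0..2 * pi / \<omega>} (\<lambda>t. f t * sin (real n * \<omega> * t))"

text \<open>The sum starts at frequency \<open>\<omega>\<close>: there is no constant term.\<close>

definition trig_series :: "real \<Rightarrow> (nat \<Rightarrow> real) \<Rightarrow> (nat \<Rightarrow> real) \<Rightarrow> real \<Rightarrow> real" where
  "trig_series \<omega> a b t =
     (\<Sum>n. a (Suc n) * cos (real (Suc n) * \<omega> * t) + b (Suc n) * sin (real (Suc n) * \<omega> * t))"

text \<open>
  Left-hand side minus right-hand side of
  \<open>x'' + (\<omega>\<^sup>2 + \<epsilon> cos (\<omega> t)) x + \<epsilon> \<alpha> x\<^sup>3 = \<epsilon> g(t)\<close>.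
\<close>

definition ode_residual ::
  "real \<Rightarrow> real \<Rightarrow> (real \<Rightarrow> real) \<Rightarrow> real \<Rightarrow> (real \<Rightarrow> real) \<Rightarrow> real \<Rightarrow> real" where
  "ode_residual \<omega> \<alpha> g \<epsilon> x t =
     deriv (deriv x) t + (\<omega>\<^sup>2 + \<epsilon> * cos (\<omega> * t)) * x t + \<epsilon> * \<alpha> * (x t) ^ 3 - \<epsilon> * g t"

text \<open>
  Two-timing.  Functions of the fast time \<open>T0 = t\<close> and the slow time \<open>T1 = \<epsilon> t\<close> are curried,
  and \<open>d/dt = D0 + \<epsilon> D1\<close>, hence \<open>d\<^sup>2/dt\<^sup>2 = D0\<^sup>2 + 2 \<epsilon> D0 D1 + O(\<epsilon>\<^sup>2)\<close>.  Inserting \<open>x0 + \<epsilon> x1 + \<dots>\<close>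
  into the equation gives \<open>D0\<^sup>2 x0 + \<omega>\<^sup>2 x0 = 0\<close> at order zero and
  \<open>D0\<^sup>2 x1 + \<omega>\<^sup>2 x1 = order_one_rhs \<omega> \<alpha> g x0\<close> at order one.
\<close>

definition D0 :: "(real \<Rightarrow> real \<Rightarrow> real) \<Rightarrow> real \<Rightarrow> real \<Rightarrow> real" where
  "D0 X T0 T1 = deriv (\<lambda>s. X s T1) T0"

definition D1 :: "(real \<Rightarrow> real \<Rightarrow> real) \<Rightarrow> real \<Rightarrow> real \<Rightarrow> real" where
  "D1 X T0 T1 = deriv (\<lambda>s. X T0 s) T1"

definition order_one_rhs ::
  "real \<Rightarrow> real \<Rightarrow> (real \<Rightarrow> real) \<Rightarrow> (real \<Rightarrow> real \<Rightarrow> real) \<Rightarrow> real \<Rightarrow> real \<Rightarrow> real" where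
  "order_one_rhs \<omega> \<alpha> g x0 T0 T1 =
     g T0 - 2 * D1 (D0 x0) T0 T1 - cos (\<omega> * T0) * x0 T0 T1 - \<alpha> * (x0 T0 T1) ^ 3"

definition order_zero_solution ::
  "real \<Rightarrow> (real \<Rightarrow> real) \<Rightarrow> (real \<Rightarrow> real) \<Rightarrow> real \<Rightarrow> real \<Rightarrow> real" where
  "order_zero_solution \<omega> A \<psi> T0 T1 = A T1 * cos (\<omega> * T0 + \<psi> T1)"

text \<open>
  The right-hand side at order one has period \<open>2 * pi / \<omega>\<close> in the fast time, so its resonant part
  (as forcing of an oscillator of frequency \<open>\<omega>\<close>) is its first Fourier mode.
\<close>

definition no_secular_terms :: "real \<Rightarrow> (real \<Rightarrow> real) \<Rightarrow> bool" where
  "no_secular_terms \<omega> F \<longleftrightarrow> fourier_cos_coeff \<omega> F 1 = 0 \<and> fourier_sin_coeff \<omega> F 1 = 0"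

definition amplitude_phase_equations ::
  "real \<Rightarrow> real \<Rightarrow> (real \<Rightarrow> real) \<Rightarrow> (real \<Rightarrow> real) \<Rightarrow> (real \<Rightarrow> real) \<Rightarrow> bool" where
  "amplitude_phase_equations \<omega> \<alpha> g A \<psi> \<longleftrightarrow>
     (\<forall>T1. A differentiable (at T1) \<and> \<psi> differentiable (at T1) \<and>
       no_secular_terms \<omega> (\<lambda>T0. order_one_rhs \<omega> \<alpha> g (order_zero_solution \<omega> A \<psi>) T0 T1))"

definition amplitude_phase_equilibrium ::
  "real \<Rightarrow> real \<Rightarrow> (real \<Rightarrow> real) \<Rightarrow> real \<Rightarrow> real \<Rightarrow> bool" where
  "amplitude_phase_equilibrium \<omega> \<alpha> g A \<psi> \<longleftrightarrow>
     amplitude_phase_equations \<omega> \<alpha> g (\<lambda>_. A) (\<lambda>_. \<psi>)"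

text \<open>
  \<open>x \<epsilon>\<close> is an approximate solution of period \<open>2 * pi / \<omega>\<close> with zeroth-order approximation \<open>x0\<close>:
  \<open>x0\<close> comes from an equilibrium of the amplitude-phase equations, and \<open>x \<epsilon> = x0 + \<epsilon> x1\<close> with
  \<open>x1\<close> periodic satisfies the equation up to \<open>O(\<epsilon>\<^sup>2)\<close>, uniformly in time.  Where the forcing \<open>g\<close>
  jumps, \<open>x1\<close> has no second derivative; as usual for discontinuous forcing it is then continuously
  differentiable and the equation is imposed away from the jumps.
\<close>

definition approx_periodic_solution ::
  "real \<Rightarrow> real \<Rightarrow> (real \<Rightarrow> real) \<Rightarrow> (real \<Rightarrow> real) \<Rightarrow> (real \<Rightarrow> real \<Rightarrow> real) \<Rightarrow> bool" where
  "approx_periodic_solution \<omega> \<alpha> g x0 x \<longleftrightarrow>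
     (\<exists>A \<psi> x1.
        amplitude_phase_equilibrium \<omega> \<alpha> g A \<psi> \<and>
        x0 = (\<lambda>t. A * cos (\<omega> * t + \<psi>)) \<and>
        x = (\<lambda>\<epsilon> t. x0 t + \<epsilon> * x1 t) \<and>
        (\<forall>t. x1 (t + 2 * pi / \<omega>) = x1 t) \<and>
        (\<forall>t. x1 differentiable (at t)) \<and>
        continuous_on UNIV (deriv x1) \<and>
        (\<forall>t. isCont g t \<longrightarrow> deriv x1 differentiable (at t)) \<and>
        (\<exists>C. \<forall>\<^sub>F \<epsilon> in at 0. \<forall>t. isCont g t \<longrightarrow> \<bar>ode_residual \<omega> \<alpha> g \<epsilon> (x \<epsilon>) t\<bar> \<le> C * \<epsilon>\<^sup>2))"

end

theory Submission
  imports Defs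
begin

text \<open>
  Two independent things have to be shown: the Fourier series of the forcing \<open>f\<close> must have a
  meaning as a function, and the formal perturbation scheme must close up at first order.

  \<^emph>\<open>The forcing.\<close>  The right-hand side of the equation is the pointwise sum of the Fourier series.
  At every continuity point of \<open>f\<close> this sum is \<open>f t\<close> (\<open>trig_series_at_continuity_point\<close>), so it
  agrees with \<open>f\<close> outside finitely many points per period; it is therefore integrable, has the same
  Fourier coefficients as \<open>f\<close>, and is discontinuous at most where \<open>f\<close> is.  The convergence is the
  Dirichlet--Jordan theorem.  Finitely many extrema make \<open>f\<close> piecewise monotone, and for a monotone
  weight \<open>h\<close> the second mean value theorem bounds \<open>\<integral> h D\<^sub>N\<close> by twice the supremum of \<open>\<bar>h\<bar>\<close> times the largest
  integral, in absolute value, of the Dirichlet kernel \<open>D\<^sub>N\<close> over a subinterval.  These kernel integrals are bounded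
  uniformly in \<open>N\<close>, and away from \<open>0\<close> they are \<open>O(1/N)\<close>.  Hence
  \<open>h u = f (t \<plusminus> u) - f t\<close>, which is small near \<open>u = 0\<close>, contributes nothing in the limit.

  \<^emph>\<open>The expansion.\<close>  Write \<open>x0 = p cos (\<omega> t) + q sin (\<omega> t)\<close>.  Multiplied by \<open>cos (\<omega> t)\<close>, it has only
  harmonics \<open>0\<close> and \<open>2\<close>, so the parametric term is not resonant, while the first harmonic of \<open>x0\<^sup>3\<close> is
  \<open>3/4 (p\<^sup>2 + q\<^sup>2)\<close> times \<open>x0\<close>.  The absence of secular terms thus means
  \<open>a 1 = 3/4 \<alpha> p (p\<^sup>2 + q\<^sup>2)\<close> and \<open>b 1 = 3/4 \<alpha> q (p\<^sup>2 + q\<^sup>2)\<close>.  Taking the sum of squares determines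
  \<open>p\<^sup>2 + q\<^sup>2\<close>, and the only solution is the pair of cube roots in the theorem, with \<open>q = ys / \<omega>\<close>.
  This proves uniqueness of the zeroth-order approximation.  For existence, the first-order
  equation is an oscillator forced at its own frequency by a function without first Fourier mode;
  variation of constants then gives a periodic correction \<open>x1\<close>
  (\<open>nonresonant_oscillator_periodic_solution\<close>), and the residual of \<open>x0 + \<epsilon> x1\<close> is \<open>\<epsilon>\<^sup>2\<close> times a
  bounded function.
\<close>

section \<open>Piecewise monotone functions\<close>

text \<open>
  The condition is local: one-sided monotonicity at every point.  By compactness it yields finitely
  many monotone pieces on each bounded interval, but it is easier to check and to transport along
  translations and reflections than a partition.  The values at the breakpoints are unconstrained.
\<close>

definition piecewise_monotone :: "(real \<Rightarrow> real) \<Rightarrow> bool" where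
  "piecewise_monotone f \<longleftrightarrow> (\<forall>t. \<exists>\<delta>>0.
     (mono_on {t<..<t+\<delta>} f \<or> antimono_on {t<..<t+\<delta>} f) \<and>
     (mono_on {t-\<delta><..<t} f \<or> antimono_on {t-\<delta><..<t} f))"

text \<open>
  Replacing the endpoint values of \<open>h\<close> by
  \<open>-M\<close> and \<open>M\<close> keeps the function monotone and changes no integral, so the second mean value theorem
  applies with these endpoint values and no one-sided limits of \<open>h\<close> are involved.
\<close>

lemma mono_integral_mult_bound:
  fixes h K :: "real \<Rightarrow> real"
  assumes "c \<le> d" and mono: "mono_on {c<..<d} h"
    and M: "0 \<le> M" "\<And>x. c < x \<Longrightarrow> x < d \<Longrightarrow> \<bar>h x\<bar> \<le> M"
    and K: "K integrable_on {c..d}"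
    and B: "\<And>p q. c \<le> p \<Longrightarrow> p \<le> q \<Longrightarrow> q \<le> d \<Longrightarrow> \<bar>integral {p..q} K\<bar> \<le> B"
  shows "(\<lambda>x. h x * K x) integrable_on {c..d}"
    and "\<bar>integral {c..d} (\<lambda>x. h x * K x)\<bar> \<le> 2 * M * B"
proof -
  define h' where "h' x = (if x \<le> c then - M else if x \<ge> d then M else h x)" for x
  \<comment> \<open>the bound \<open>M\<close> is what makes the jumps at the two endpoints go in the right direction\<close>
  have h'_mono: "h' x \<le> h' y" if "c \<le> x" "x \<le> y" "y \<le> d" for x y
    using that M(1) M(2)[of x] M(2)[of y] mono_onD[OF mono, of x y]
    by (auto simp: h'_def abs_le_iff)
  obtain e where e: "e \<in> {c..d}"
    "((\<lambda>x. h' x * K x) has_integral (h' c * integral {c..e} K + h' d * integral {e..d} K)) {c..d}"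
    using second_mean_value_theorem_full[OF K \<open>c \<le> d\<close>, of h'] h'_mono by blast
  have int: "((\<lambda>x. h x * K x) has_integral (h' c * integral {c..e} K + h' d * integral {e..d} K)) {c..d}"
    by (rule has_integral_spike_finite[OF _ _ e(2), of "{c,d}"]) (auto simp: h'_def)
  then show "(\<lambda>x. h x * K x) integrable_on {c..d}"
    by blast
  have h'_bound: "\<bar>h' x\<bar> \<le> M" for x
    using M by (auto simp: h'_def)
  have "\<bar>h' c * integral {c..e} K + h' d * integral {e..d} K\<bar>
      \<le> \<bar>h' c\<bar> * \<bar>integral {c..e} K\<bar> + \<bar>h' d\<bar> * \<bar>integral {e..d} K\<bar>"
    by (metis abs_mult abs_triangle_ineq)
  also have "\<dots> \<le> M * B + M * B"
    using e(1) by (intro add_mono mult_mono h'_bound B M) auto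
  finally show "\<bar>integral {c..d} (\<lambda>x. h x * K x)\<bar> \<le> 2 * M * B"
    using integral_unique[OF int] by (simp add: mult.commute mult.left_commute)
qed

lemma monotone_integral_mult_bound:
  fixes h K :: "real \<Rightarrow> real"
  assumes "c \<le> d" and mono: "mono_on {c<..<d} h \<or> antimono_on {c<..<d} h"
    and M: "0 \<le> M" "\<And>x. c < x \<Longrightarrow> x < d \<Longrightarrow> \<bar>h x\<bar> \<le> M"
    and K: "K integrable_on {c..d}"
    and B: "\<And>p q. c \<le> p \<Longrightarrow> p \<le> q \<Longrightarrow> q \<le> d \<Longrightarrow> \<bar>integral {p..q} K\<bar> \<le> B"
  shows "(\<lambda>x. h x * K x) integrable_on {c..d}"
    and "\<bar>integral {c..d} (\<lambda>x. h x * K x)\<bar> \<le> 2 * M * B"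
proof -
  have "(\<lambda>x. h x * K x) integrable_on {c..d} \<and> \<bar>integral {c..d} (\<lambda>x. h x * K x)\<bar> \<le> 2 * M * B"
    using mono
  proof
    assume "mono_on {c<..<d} h"
    from mono_integral_mult_bound[OF \<open>c \<le> d\<close> this M K B] show ?thesis by simp
  next
    assume "antimono_on {c<..<d} h"
    then have "mono_on {c<..<d} (\<lambda>x. - h x)"
      by (auto simp: monotone_on_def)
    from mono_integral_mult_bound[OF \<open>c \<le> d\<close> this M(1) _ K B] M(2)
    show ?thesis by (simp add: integrable_neg_iff)
  qed
  then show "(\<lambda>x. h x * K x) integrable_on {c..d}"
    "\<bar>integral {c..d} (\<lambda>x. h x * K x)\<bar> \<le> 2 * M * B" by auto
qed

lemma integral_subinterval_bound:
  fixes K :: "real \<Rightarrow> real"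
  assumes K: "K integrable_on {c..d}"
  obtains B where "\<And>p q. c \<le> p \<Longrightarrow> p \<le> q \<Longrightarrow> q \<le> d \<Longrightarrow> \<bar>integral {p..q} K\<bar> \<le> B"
proof -
  have "bounded ((\<lambda>x. integral {c..x} K) ` {c..d})"
    using indefinite_integral_continuous_1[OF K] compact_continuous_image
      compact_imp_bounded by blast
  then obtain B where B: "\<forall>x\<in>{c..d}. \<bar>integral {c..x} K\<bar> \<le> B"
    by (auto simp: bounded_iff)
  have "\<bar>integral {p..q} K\<bar> \<le> 2 * B" if "c \<le> p" "p \<le> q" "q \<le> d" for p q
  proof -
    have "integral {c..p} K + integral {p..q} K = integral {c..q} K"
      by (rule Henstock_Kurzweil_Integration.integral_combine) (use that integrable_subinterval_real[OF K] in auto)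
    then show ?thesis
      using B[rule_format, of p] B[rule_format, of q] that by auto
  qed
  then show thesis by (rule that)
qed

text \<open>
  Bisection in place of a partition: a property of intervals that is additive and holds on the
  intervals of monotonicity holds on every bounded interval.
\<close>

lemma piecewise_monotone_induct [consumes 2, case_names split monotone]:
  assumes "a \<le> b" and f: "piecewise_monotone f"
    and split: "\<And>c d e. a \<le> c \<Longrightarrow> c \<le> d \<Longrightarrow> d \<le> e \<Longrightarrow> e \<le> b \<Longrightarrow> P c d \<Longrightarrow> P d e \<Longrightarrow> P c e"
    and monotone: "\<And>c d. a \<le> c \<Longrightarrow> c \<le> d \<Longrightarrow> d \<le> b \<Longrightarrow>
      mono_on {c<..<d} f \<or> antimono_on {c<..<d} f \<Longrightarrow> P c d"
  shows "P a b"
proof -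
  define Q where "Q p q \<longleftrightarrow> (a \<le> p \<and> q \<le> b \<longrightarrow> P p q)" for p q
  have "Q a b"
    using \<open>a \<le> b\<close>
  proof (induction rule: Bolzano)
    case (trans p q r)
    then show ?case
      using split unfolding Q_def by auto
  next
    case (local x)
    obtain \<delta> where "\<delta> > 0"
      and \<delta>: "mono_on {x<..<x+\<delta>} f \<or> antimono_on {x<..<x+\<delta>} f"
         "mono_on {x-\<delta><..<x} f \<or> antimono_on {x-\<delta><..<x} f"
      using f unfolding piecewise_monotone_def by blast
    have "P p q" if "p \<le> x" "x \<le> q" "q - p < \<delta>" "a \<le> p" "q \<le> b" for p q
    proof (rule split[of p x q])
      show "P p x"
        by (rule monotone) (use that local \<delta>(2) in \<open>auto simp: monotone_on_def\<close>)
      show "P x q"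
        by (rule monotone) (use that local \<delta>(1) in \<open>auto simp: monotone_on_def\<close>)
    qed (use that in auto)
    then show ?case
      using \<open>\<delta> > 0\<close> unfolding Q_def by blast
  qed
  then show ?thesis by (simp add: Q_def)
qed

lemma piecewise_monotone_mult_integrable:
  fixes f K :: "real \<Rightarrow> real"
  assumes f: "piecewise_monotone f" "bounded (range f)" and K: "K integrable_on {a..b}"
  shows "(\<lambda>x. f x * K x) integrable_on {a..b}"
proof (cases "a \<le> b")
  case True
  obtain M where M: "\<And>x. \<bar>f x\<bar> \<le> M"
    using f(2) by (auto simp: bounded_iff)
  have "0 \<le> M" using M[of 0] by simp
  from True f(1) show ?thesis
  proof (induction rule: piecewise_monotone_induct)
    case (split c d e)
    then show ?case by (intro Henstock_Kurzweil_Integration.integrable_combine[of c d e])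
  next
    case (monotone c d)
    have K': "K integrable_on {c..d}"
      by (rule integrable_subinterval_real[OF K]) (use monotone in auto)
    obtain B where "\<And>p q. c \<le> p \<Longrightarrow> p \<le> q \<Longrightarrow> q \<le> d \<Longrightarrow> \<bar>integral {p..q} K\<bar> \<le> B"
      using integral_subinterval_bound[OF K'] by blast
    from monotone_integral_mult_bound(1)[OF \<open>c \<le> d\<close> monotone(4) \<open>0 \<le> M\<close> M K' this]
    show ?case .
  qed
qed auto

section \<open>The Dirichlet kernel\<close>

definition dirichlet_kernel :: "nat \<Rightarrow> real \<Rightarrow> real" where
  "dirichlet_kernel N u = 1 / 2 + (\<Sum>n<N. cos (real (Suc n) * u))"

lemma dirichlet_kernel_closed_form:
  "2 * sin (u / 2) * dirichlet_kernel N u = sin ((real N + 1 / 2) * u)"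
proof (induction N)
  case (Suc N)
  have "2 * sin (u / 2) * dirichlet_kernel (Suc N) u =
      sin ((real N + 1 / 2) * u) + 2 * sin (u / 2) * cos (real (Suc N) * u)"
    using Suc by (simp add: dirichlet_kernel_def algebra_simps)
  also have "2 * sin (u / 2) * cos (real (Suc N) * u) =
      sin (real (Suc N) * u + u / 2) - sin (real (Suc N) * u - u / 2)"
    by (simp add: sin_add sin_diff)
  also have "real (Suc N) * u - u / 2 = (real N + 1 / 2) * u"
    by (simp add: field_simps)
  also have "real (Suc N) * u + u / 2 = (real (Suc N) + 1 / 2) * u"
    by (simp add: field_simps)
  finally show ?case by simp
qed (simp add: dirichlet_kernel_def)

lemma continuous_dirichlet_kernel: "continuous_on S (dirichlet_kernel N)"
  unfolding dirichlet_kernel_def by (intro continuous_intros)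

lemma integrable_dirichlet_kernel: "dirichlet_kernel N integrable_on {a..b}"
  by (intro integrable_continuous_real continuous_dirichlet_kernel)

lemma abs_dirichlet_kernel_le: "\<bar>dirichlet_kernel N u\<bar> \<le> real N + 1 / 2"
proof -
  have "\<bar>\<Sum>n<N. cos (real (Suc n) * u)\<bar> \<le> (\<Sum>n<N. 1)"
    by (intro sum_abs[THEN order_trans] sum_mono) simp
  then show ?thesis
    unfolding dirichlet_kernel_def by simp
qed

lemma dirichlet_kernel_has_integral:
  "(dirichlet_kernel N has_integral pi / 2) {0..pi}"
proof -
  have "(dirichlet_kernel N has_integral
      ((pi / 2 + (\<Sum>n<N. sin (real (Suc n) * pi) / real (Suc n)))
       - (0 / 2 + (\<Sum>n<N. sin (real (Suc n) * 0) / real (Suc n))))) {0..pi}"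
  proof (rule fundamental_theorem_of_calculus)
    fix x :: real
    have "((\<lambda>u. u / 2 + (\<Sum>n<N. sin (real (Suc n) * u) / real (Suc n))) has_real_derivative
       dirichlet_kernel N x) (at x within {0..pi})"
      unfolding dirichlet_kernel_def
      by (auto intro!: derivative_eq_intros sum.cong simp del: of_nat_Suc)
    then show "((\<lambda>u. u / 2 + (\<Sum>n<N. sin (real (Suc n) * u) / real (Suc n))) has_vector_derivative
       dirichlet_kernel N x) (at x within {0..pi})"
      by (simp add: has_real_derivative_iff_has_vector_derivative)
  qed simp
  moreover have "sin (real (Suc n) * pi) = 0" for n
    using sin_npi[of "Suc n"] by simp
  ultimately show ?thesis by simp
qed

lemma sin_ge_half_self:
  fixes x :: real
  assumes "0 \<le> x" "x \<le> pi / 2"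
  shows "x / 2 \<le> sin x"
proof (cases "x \<le> pi / 3")
  case True
  have "sin 0 - 0 / 2 \<le> sin x - x / 2"
  proof (rule DERIV_nonneg_imp_nondecreasing[OF assms(1)])
    fix y assume y: "0 \<le> y" "y \<le> x"
    have "cos (pi / 3) \<le> cos y"
      using y True by (subst cos_mono_le_eq) auto
    moreover have "((\<lambda>x. sin x - x / 2) has_real_derivative cos y - 1 / 2) (at y)"
      by (auto intro!: derivative_eq_intros)
    ultimately show "\<exists>d. ((\<lambda>x. sin x - x / 2) has_real_derivative d) (at y) \<and> 0 \<le> d"
      by (auto simp: cos_60)
  qed
  then show ?thesis by simp
next
  case False
  have "sin (pi / 3) \<le> sin x"
    using False assms by (subst sin_mono_le_eq) auto
  moreover have "(17/10 :: real) \<le> sqrt 3"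
    by (rule real_le_rsqrt) (simp add: power2_eq_square)
  moreover have "pi < 3.2" using pi_approx by simp
  ultimately show ?thesis
    using assms by (simp add: sin_60)
qed

lemma integral_sin_bound:
  fixes k :: real
  assumes "k > 0" "p \<le> q"
  shows "\<bar>integral {p..q} (\<lambda>u. sin (k * u))\<bar> \<le> 2 / k"
proof -
  have "((\<lambda>u. sin (k * u)) has_integral ((- cos (k * q) / k) - (- cos (k * p) / k))) {p..q}"
    by (rule fundamental_theorem_of_calculus)
      (use assms in \<open>auto intro!: derivative_eq_intros
         simp flip: has_real_derivative_iff_has_vector_derivative\<close>)
  then have "integral {p..q} (\<lambda>u. sin (k * u)) = (cos (k * p) - cos (k * q)) / k"
    by (simp add: integral_unique diff_divide_distrib)
  moreover have "\<bar>cos (k * p) - cos (k * q)\<bar> \<le> 2"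
    using cos_ge_minus_one[of "k*p"] cos_ge_minus_one[of "k*q"] cos_le_one[of "k*p"] cos_le_one[of "k*q"]
    by linarith
  ultimately show ?thesis
    using assms by (simp add: abs_divide divide_right_mono)
qed

text \<open>
  On \<open>{c..d}\<close> the kernel is the oscillation \<open>sin ((N + 1/2) u)\<close>, whose integrals are at most
  \<open>2 / (N + 1/2)\<close>, times the decreasing weight \<open>1 / (2 sin (u/2))\<close>.
\<close>

lemma dirichlet_kernel_integral_away_from_0:
  assumes "0 < c" "c \<le> d" "d \<le> pi"
  shows "\<bar>integral {c..d} (dirichlet_kernel N)\<bar> \<le> 8 / (c * (real N + 1 / 2))"
proof -
  let ?k = "real N + 1 / 2" and ?h = "\<lambda>u. 1 / (2 * sin (u / 2))"
  have sin_pos: "0 < sin (u / 2)" if "c \<le> u" "u \<le> d" for u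
    using that assms by (intro sin_gt_zero) auto
  have sin_mono: "sin (u / 2) \<le> sin (v / 2)" if "c \<le> u" "u \<le> v" "v \<le> d" for u v
    using that assms by (subst sin_mono_le_eq) auto
  have "\<bar>integral {c..d} (\<lambda>u. ?h u * sin (?k * u))\<bar> \<le> 2 * (1 / (2 * sin (c / 2))) * (2 / ?k)"
  proof (rule monotone_integral_mult_bound(2))
    show "mono_on {c<..<d} ?h \<or> antimono_on {c<..<d} ?h"
    proof (rule disjI2, rule monotone_onI)
      fix u v assume "u \<in> {c<..<d}" "v \<in> {c<..<d}" "u \<le> v"
      then show "?h v \<le> ?h u"
        using sin_pos[of u] sin_mono[of u v] by (intro divide_left_mono) auto
    qed
    show "0 \<le> 1 / (2 * sin (c / 2))"
      using sin_pos[of c] assms by simp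
    show "\<bar>?h u\<bar> \<le> 1 / (2 * sin (c / 2))" if "c < u" "u < d" for u
      using sin_pos[of u] sin_pos[of c] sin_mono[of c u] that assms by (auto intro!: divide_left_mono)
    show "(\<lambda>u. sin (?k * u)) integrable_on {c..d}"
      by (intro integrable_continuous_real continuous_intros)
    show "\<bar>integral {p..q} (\<lambda>u. sin (?k * u))\<bar> \<le> 2 / ?k" if "p \<le> q" for p q
      by (rule integral_sin_bound) (use that in auto)
  qed fact
  also have "integral {c..d} (\<lambda>u. ?h u * sin (?k * u)) = integral {c..d} (dirichlet_kernel N)"
  proof (rule integral_cong)
    fix u assume "u \<in> {c..d}"
    then show "?h u * sin (?k * u) = dirichlet_kernel N u"
      using sin_pos[of u] dirichlet_kernel_closed_form[of u N] by (simp add: field_simps)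
  qed
  also have "2 * (1 / (2 * sin (c / 2))) * (2 / ?k) = 2 / (sin (c / 2) * ?k)"
    by simp
  also have "\<dots> \<le> 2 / ((c / 4) * ?k)"
    using sin_ge_half_self[of "c / 2"] assms
    by (intro divide_left_mono mult_right_mono mult_pos_pos) auto
  finally show ?thesis by simp
qed

text \<open>
  The scale \<open>1 / (N + 1/2)\<close> separates two regimes: below it the trivial bound \<open>N + 1/2\<close> on the kernel
  contributes at most \<open>1\<close>, above it the oscillation contributes at most \<open>8\<close>.
\<close>

lemma dirichlet_kernel_integral_bound:
  assumes "0 \<le> c" "c \<le> d" "d \<le> pi"
  shows "\<bar>integral {c..d} (dirichlet_kernel N)\<bar> \<le> 9"
proof -
  let ?k = "real N + 1 / 2"
  define m where "m = max c (min d (1 / ?k))"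
  have m: "c \<le> m" "m \<le> d" using assms by (auto simp: m_def)
  have "norm (integral {c..m} (dirichlet_kernel N)) \<le> ?k * (m - c)"
    using m abs_dirichlet_kernel_le
    by (intro integral_bound continuous_dirichlet_kernel) auto
  also have "m - c \<le> 1 / ?k"
    using assms by (auto simp: m_def max_def min_def)
  then have "?k * (m - c) \<le> ?k * (1 / ?k)"
    by (intro mult_left_mono) auto
  finally have 1: "\<bar>integral {c..m} (dirichlet_kernel N)\<bar> \<le> 1"
    by simp
  have 2: "\<bar>integral {m..d} (dirichlet_kernel N)\<bar> \<le> 8"
  proof (cases "m = d")
    case False
    then have mk: "1 / ?k \<le> m" "0 < m"
      using m by (auto simp: m_def max_def min_def split: if_splits)
        (smt (verit) divide_pos_pos of_nat_0_le_iff)+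
    have "\<bar>integral {m..d} (dirichlet_kernel N)\<bar> \<le> 8 / (m * ?k)"
      by (rule dirichlet_kernel_integral_away_from_0) (use mk m assms in auto)
    also have "1 \<le> m * ?k" using mk by (simp add: field_simps)
    then have "8 / (m * ?k) \<le> 8" by (simp add: field_simps)
    finally show ?thesis .
  qed simp
  have "integral {c..m} (dirichlet_kernel N) + integral {m..d} (dirichlet_kernel N)
      = integral {c..d} (dirichlet_kernel N)"
    by (intro Henstock_Kurzweil_Integration.integral_combine m integrable_dirichlet_kernel)
  with 1 2 show ?thesis by linarith
qed

text \<open>
  A weight that tends to \<open>0\<close> at \<open>0\<close> is uniformly small on some \<open>{0..\<delta>}\<close>, where the kernel integrals
  are only bounded; on \<open>{\<delta>..pi}\<close> the weight is only bounded, but there the kernel integrals are \<open>O(1/N)\<close>.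
\<close>

lemma dirichlet_kernel_localization:
  assumes h: "piecewise_monotone h" "bounded (range h)" and h0: "(h \<longlongrightarrow> 0) (at_right 0)"
  shows "(\<lambda>N. integral {0..pi} (\<lambda>u. h u * dirichlet_kernel N u)) \<longlonglongrightarrow> 0"
proof (rule LIMSEQ_I)
  fix r :: real assume "r > 0"
  obtain M where M: "\<And>x. \<bar>h x\<bar> \<le> M"
    using h(2) by (auto simp: bounded_iff)
  have "0 \<le> M" using M[of 0] by simp
  obtain \<delta>1 where \<delta>1: "\<delta>1 > 0" "mono_on {0<..<0+\<delta>1} h \<or> antimono_on {0<..<0+\<delta>1} h"
    using h(1) unfolding piecewise_monotone_def by blast
  have "\<forall>\<^sub>F u in at_right 0. \<bar>h u\<bar> < r / 36"
    using tendstoD[OF h0, of "r / 36"] \<open>r > 0\<close> by simp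
  then obtain \<delta>2 where \<delta>2: "\<delta>2 > 0" "\<And>u. 0 < u \<Longrightarrow> u < \<delta>2 \<Longrightarrow> \<bar>h u\<bar> < r / 36"
    by (auto simp: eventually_at_right_field)
  define \<delta> where "\<delta> = min pi (min \<delta>1 \<delta>2)"
  have \<delta>: "0 < \<delta>" "\<delta> \<le> pi" "\<delta> \<le> \<delta>1" "\<delta> \<le> \<delta>2"
    using \<delta>1 \<delta>2 by (auto simp: \<delta>_def)
  have int: "(\<lambda>u. h u * dirichlet_kernel N u) integrable_on {c..d}" for N c d
    by (intro piecewise_monotone_mult_integrable h integrable_dirichlet_kernel)
  \<comment> \<open>with \<open>\<bar>h\<bar> \<le> r / 36\<close> and kernel integrals at most \<open>9\<close> this is \<open>2 * (r / 36) * 9\<close>\<close>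
  have near: "\<bar>integral {0..\<delta>} (\<lambda>u. h u * dirichlet_kernel N u)\<bar> \<le> r / 2" for N
  proof -
    have "\<bar>integral {0..\<delta>} (\<lambda>u. h u * dirichlet_kernel N u)\<bar> \<le> 2 * (r / 36) * 9"
    proof (rule monotone_integral_mult_bound(2))
      show "mono_on {0<..<\<delta>} h \<or> antimono_on {0<..<\<delta>} h"
        using \<delta>1(2) \<delta>(3) by (auto simp: monotone_on_def)
      show "\<bar>h x\<bar> \<le> r / 36" if "0 < x" "x < \<delta>" for x
        using \<delta>2(2)[of x] that \<delta> by auto
    qed (use \<delta> \<open>r > 0\<close> in \<open>auto intro: dirichlet_kernel_integral_bound integrable_dirichlet_kernel\<close>)
    then show ?thesis by simp
  qed
  have "(\<lambda>N. integral {\<delta>..pi} (\<lambda>u. h u * dirichlet_kernel N u)) \<longlonglongrightarrow> 0"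
    using \<delta>(2) h(1)
  proof (induction rule: piecewise_monotone_induct)
    case (split c d e)
    have "integral {c..e} (\<lambda>u. h u * dirichlet_kernel N u) =
      integral {c..d} (\<lambda>u. h u * dirichlet_kernel N u) + integral {d..e} (\<lambda>u. h u * dirichlet_kernel N u)" for N
      by (rule Henstock_Kurzweil_Integration.integral_combine[OF split(2,3) int, symmetric])
    then show ?case
      using tendsto_add[OF split(5,6)] by simp
  next
    case (monotone c d)
    have bd: "\<bar>integral {c..d} (\<lambda>u. h u * dirichlet_kernel N u)\<bar> \<le> 2 * M * (8 / (\<delta> * (real N + 1 / 2)))" for N
    proof (rule monotone_integral_mult_bound(2))
      fix p q assume pq: "c \<le> p" "p \<le> q" "q \<le> d"
      have "\<bar>integral {p..q} (dirichlet_kernel N)\<bar> \<le> 8 / (p * (real N + 1 / 2))"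
        using pq monotone \<delta> by (intro dirichlet_kernel_integral_away_from_0) auto
      also have "\<dots> \<le> 8 / (\<delta> * (real N + 1 / 2))"
        using pq monotone \<delta> by (intro divide_left_mono mult_right_mono mult_pos_pos) auto
      finally show "\<bar>integral {p..q} (dirichlet_kernel N)\<bar> \<le> 8 / (\<delta> * (real N + 1 / 2))" .
    qed ((fact monotone \<open>0 \<le> M\<close> | rule M integrable_dirichlet_kernel)+)
    have "2 * M * (8 / (\<delta> * (real N + 1 / 2))) \<le> 32 * M / \<delta> * inverse (real (Suc N))" for N
    proof -
      have "8 / (\<delta> * (real N + 1 / 2)) \<le> 8 / (\<delta> * (real (Suc N) / 2))"
        using \<delta>(1) by (intro divide_left_mono mult_left_mono mult_pos_pos) auto
      then have "2 * M * (8 / (\<delta> * (real N + 1 / 2))) \<le> 2 * M * (8 / (\<delta> * (real (Suc N) / 2)))"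
        using \<open>0 \<le> M\<close> by (intro mult_left_mono) auto
      then show ?thesis by (simp add: field_simps)
    qed
    then have bd': "norm (integral {c..d} (\<lambda>u. h u * dirichlet_kernel N u)) \<le> 32 * M / \<delta> * inverse (real (Suc N))" for N
      using bd[of N] by (simp add: order_trans[OF bd])
    show ?case
      by (rule Lim_null_comparison[OF always_eventually tendsto_mult_right_zero[OF LIMSEQ_inverse_real_of_nat]])
        (use bd' in blast)
  qed
  then obtain N0 where N0: "\<And>N. N \<ge> N0 \<Longrightarrow> \<bar>integral {\<delta>..pi} (\<lambda>u. h u * dirichlet_kernel N u)\<bar> < r / 2"
    using LIMSEQ_D[of _ 0 "r / 2"] \<open>r > 0\<close> by fastforce
  show "\<exists>N0. \<forall>N\<ge>N0. norm (integral {0..pi} (\<lambda>u. h u * dirichlet_kernel N u) - 0) < r"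
  proof (intro exI allI impI)
    fix N assume "N \<ge> N0"
    have "integral {0..\<delta>} (\<lambda>u. h u * dirichlet_kernel N u) + integral {\<delta>..pi} (\<lambda>u. h u * dirichlet_kernel N u)
      = integral {0..pi} (\<lambda>u. h u * dirichlet_kernel N u)"
      using \<delta> by (intro Henstock_Kurzweil_Integration.integral_combine int) auto
    then show "norm (integral {0..pi} (\<lambda>u. h u * dirichlet_kernel N u) - 0) < r"
      using near[of N] N0[OF \<open>N \<ge> N0\<close>] by simp
  qed
qed

section \<open>Primitives and integrals over a period\<close>

text \<open>
  An antiderivative on the whole real line.  Integrals over \<open>{a..b}\<close> with \<open>b < a\<close> are zero, so exactly one
  of the two terms is present when \<open>t \<noteq> 0\<close>.
\<close>

definition primitive :: "(real \<Rightarrow> real) \<Rightarrow> real \<Rightarrow> real" where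
  "primitive h t = integral {0..t} h - integral {t..0} h"

lemma primitive_0 [simp]: "primitive h 0 = 0"
  by (simp add: primitive_def)

lemma primitive_nonneg: "0 \<le> t \<Longrightarrow> primitive h t = integral {0..t} h"
  by (cases "t = 0") (simp_all add: primitive_def)

lemma integral_eq_primitive_diff:
  assumes h: "\<And>c d. h integrable_on {c..d}" and "c \<le> d"
  shows "integral {c..d} h = primitive h d - primitive h c"
proof -
  note comb = Henstock_Kurzweil_Integration.integral_combine[OF _ _ h]
  consider "0 \<le> c" | "c < 0" "0 \<le> d" | "d < 0" by linarith
  then show ?thesis
  proof cases
    case 1
    with \<open>c \<le> d\<close> comb[of 0 c d] show ?thesis by (auto simp: primitive_nonneg)
  next
    case 2
    with comb[of c 0 d] show ?thesis by (cases "d = 0") (auto simp: primitive_def)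
  next
    case 3
    with \<open>c \<le> d\<close> comb[of c d 0] show ?thesis by (auto simp: primitive_def)
  qed
qed

lemma primitive_eq_integral:
  assumes h: "\<And>c d. h integrable_on {c..d}" and "c \<le> t"
  shows "primitive h t = integral {c..t} h + primitive h c"
  using integral_eq_primitive_diff[where h=h, OF h \<open>c \<le> t\<close>] by linarith

lemma continuous_on_primitive:
  assumes h: "\<And>c d. h integrable_on {c..d}"
  shows "continuous_on UNIV (primitive h)"
proof -
  have "isCont (primitive h) t" for t
  proof -
    have "continuous_on {t-1..t+1} (\<lambda>x. integral {t-1..x} h + primitive h (t-1))"
      by (intro continuous_intros indefinite_integral_continuous_1 h)
    then have "continuous_on {t-1..t+1} (primitive h)"
      by (rule continuous_on_eq) (auto simp: primitive_eq_integral[where h=h and c="t-1", OF h, symmetric])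
    then have "continuous_on {t-1<..<t+1} (primitive h)"
      by (rule continuous_on_subset) auto
    then show ?thesis
      by (simp add: continuous_on_eq_continuous_at)
  qed
  then show ?thesis
    by (simp add: continuous_on_eq_continuous_at)
qed

lemma primitive_has_real_derivative:
  assumes h: "\<And>c d. h integrable_on {c..d}" and "isCont h t"
  shows "(primitive h has_real_derivative h t) (at t)"
proof -
  have "((\<lambda>x. integral {t-1..x} h) has_vector_derivative h t) (at t within {t-1..t+1} - {})"
    by (rule integral_has_vector_derivative_continuous_at[OF h])
      (use \<open>isCont h t\<close> continuous_at_imp_continuous_at_within in auto)
  then have "((\<lambda>x. integral {t-1..x} h) has_real_derivative h t) (at t within {t-1<..<t+1})"
    unfolding has_real_derivative_iff_has_vector_derivative
    by (rule has_vector_derivative_within_subset) auto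
  then have "((\<lambda>x. integral {t-1..x} h) has_real_derivative h t) (at t)"
    by (simp add: at_within_open[of t "{t-1<..<t+1}"])
  then have "((\<lambda>x. integral {t-1..x} h + primitive h (t-1)) has_real_derivative h t) (at t)"
    by (auto intro!: derivative_eq_intros)
  then show ?thesis
    by (rule has_field_derivative_transform_within_open[where S = "{t-1<..<t+1}"])
      (auto simp: primitive_eq_integral[where h=h and c="t-1", OF h, symmetric])
qed

lemma integral_periodic_shift:
  fixes h :: "real \<Rightarrow> real"
  assumes "\<And>t. h (t + T) = h t"
  shows "integral {c+T..d+T} h = integral {c..d} h"
proof -
  have "h \<circ> (+) T = h"
    unfolding fun_eq_iff o_def using assms by (metis add.commute)
  with integral_shift_Icc_real[of c d h T] show ?thesis
    by simp
qed

text \<open>The increment over one period depends on the starting point only through differences that cancel by periodicity.\<close>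

lemma primitive_period_increment:
  assumes h: "\<And>c d. h integrable_on {c..d}" and per: "\<And>t. h (t + T) = h t"
  shows "primitive h (t + T) - primitive h t = primitive h T"
proof -
  have "primitive h (d + T) - primitive h (c + T) = primitive h d - primitive h c" if "c \<le> d" for c d
    using integral_periodic_shift[where h=h and T=T, OF per, of c d] that
      integral_eq_primitive_diff[where h=h, OF h, of c d] integral_eq_primitive_diff[where h=h, OF h, of "c+T" "d+T"]
    by linarith
  from this[of 0 t] this[of t 0] show ?thesis
    by (cases "0 \<le> t") auto
qed

lemma integral_over_period:
  fixes h :: "real \<Rightarrow> real"
  assumes h: "\<And>c d. h integrable_on {c..d}" and per: "\<And>t. h (t + T) = h t" and "0 \<le> T"
  shows "integral {t..t+T} h = integral {0..T} h"
  using primitive_period_increment[where h=h and T=T, OF h per, of t] \<open>0 \<le> T\<close>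
    integral_eq_primitive_diff[where h=h, OF h, of t "t + T"] primitive_nonneg[of T h]
  by linarith

section \<open>Pointwise convergence of Fourier series\<close>

lemma piecewise_monotone_affine:
  assumes "piecewise_monotone f" "k \<noteq> 0"
  shows "piecewise_monotone (\<lambda>u. f (c + k * u) - m)"
  unfolding piecewise_monotone_def
proof
  fix t
  define t' where "t' = c + k * t"
  obtain \<delta> where \<delta>: "\<delta> > 0"
    "mono_on {t'<..<t'+\<delta>} f \<or> antimono_on {t'<..<t'+\<delta>} f"
    "mono_on {t'-\<delta><..<t'} f \<or> antimono_on {t'-\<delta><..<t'} f"
    using assms(1) unfolding piecewise_monotone_def by blast
  define S where "S = {t<..<t + \<delta> / \<bar>k\<bar>}"
  define S' where "S' = {t - \<delta> / \<bar>k\<bar><..<t}"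
  define R where "R = {t'<..<t'+\<delta>}"
  define R' where "R' = {t'-\<delta><..<t'}"
  let ?g = "\<lambda>u. f (c + k * u) - m"
  have "(mono_on S ?g \<or> antimono_on S ?g) \<and> (mono_on S' ?g \<or> antimono_on S' ?g)"
  proof (cases "k > 0")
    case True
    have "c + k * u \<in> R" if "u \<in> S" for u
      using True that by (auto simp: S_def R_def t'_def field_simps)
    moreover have "c + k * u \<in> R'" if "u \<in> S'" for u
      using True that by (auto simp: S'_def R'_def t'_def field_simps)
    ultimately show ?thesis
      using \<delta>(2,3) True unfolding R_def[symmetric] R'_def[symmetric]
      by (auto simp: monotone_on_def)
  next
    case False
    with \<open>k \<noteq> 0\<close> have "k < 0" by simp
    have "c + k * u \<in> R'" if "u \<in> S" for u
      using \<open>k < 0\<close> that by (auto simp: S_def R'_def t'_def field_simps)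
    moreover have "c + k * u \<in> R" if "u \<in> S'" for u
      using \<open>k < 0\<close> that by (auto simp: S'_def R_def t'_def field_simps)
    ultimately show ?thesis
      using \<delta>(2,3) \<open>k < 0\<close> unfolding R_def[symmetric] R'_def[symmetric]
      by (auto simp: monotone_on_def)
  qed
  then show "\<exists>\<delta>>0. (mono_on {t<..<t+\<delta>} ?g \<or> antimono_on {t<..<t+\<delta>} ?g) \<and>
     (mono_on {t-\<delta><..<t} ?g \<or> antimono_on {t-\<delta><..<t} ?g)"
    using \<open>\<delta> > 0\<close> \<open>k \<noteq> 0\<close> unfolding S_def S'_def by (intro exI[of _ "\<delta> / \<bar>k\<bar>"]) auto
qed

text \<open>
  The addition theorem for the cosine turns the partial sum into a convolution with the Dirichlet
  kernel.  Its integrand is periodic, so the window may be centred at \<open>t\<close>; reflecting the left half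
  uses that the kernel is even.
\<close>

lemma fourier_partial_sum_eq:
  fixes F :: "real \<Rightarrow> real"
  assumes int: "\<And>c d K. continuous_on UNIV K \<Longrightarrow> (\<lambda>s. F s * K s) integrable_on {c..d}"
    and per: "\<And>s. F (s + 2 * pi) = F s"
  shows "fourier_cos_coeff 1 F 0 / 2 + (\<Sum>n<N. fourier_cos_coeff 1 F (Suc n) * cos (real (Suc n) * t)
       + fourier_sin_coeff 1 F (Suc n) * sin (real (Suc n) * t))
     = 1 / pi * (integral {0..pi} (\<lambda>u. F (t + u) * dirichlet_kernel N u)
               + integral {0..pi} (\<lambda>u. F (t - u) * dirichlet_kernel N u))"
proof -
  let ?C = "\<lambda>n s. cos (real n * s)" and ?S = "\<lambda>n s. sin (real n * s)"
  let ?G = "\<lambda>s. F s * dirichlet_kernel N (s - t)"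
  have intC: "(\<lambda>s. F s * ?C n s) integrable_on {c..d}" and intS: "(\<lambda>s. F s * ?S n s) integrable_on {c..d}" for n c d
    by (intro int continuous_intros)+
  have intG: "?G integrable_on {c..d}" for c d
    by (intro int continuous_on_compose2[OF continuous_dirichlet_kernel[of UNIV]] continuous_intros) auto
  have term_eq: "integral {0..2*pi} (\<lambda>s. F s * ?C n s) * ?C n t + integral {0..2*pi} (\<lambda>s. F s * ?S n s) * ?S n t
    = integral {0..2*pi} (\<lambda>s. F s * cos (real n * (s - t)))" for n
  proof -
    have "integral {0..2*pi} (\<lambda>s. F s * ?C n s) * ?C n t + integral {0..2*pi} (\<lambda>s. F s * ?S n s) * ?S n t
      = integral {0..2*pi} (\<lambda>s. F s * ?C n s * ?C n t + F s * ?S n s * ?S n t)"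
      by (subst integral_add) (auto intro!: integrable_on_mult_left intC intS)
    then show ?thesis
      by (simp add: right_diff_distrib cos_diff algebra_simps)
  qed
  have int_shift: "(\<lambda>s. F s * cos (real n * (s - t))) integrable_on {c..d}" for n c d
    by (intro int continuous_intros)
  have "pi * (fourier_cos_coeff 1 F 0 / 2 + (\<Sum>n<N. fourier_cos_coeff 1 F (Suc n) * ?C (Suc n) t
       + fourier_sin_coeff 1 F (Suc n) * ?S (Suc n) t))
     = integral {0..2*pi} (\<lambda>s. F s * (1 / 2)) +
       (\<Sum>n<N. integral {0..2*pi} (\<lambda>s. F s * ?C (Suc n) s) * ?C (Suc n) t
          + integral {0..2*pi} (\<lambda>s. F s * ?S (Suc n) s) * ?S (Suc n) t)"
    by (simp add: fourier_cos_coeff_def fourier_sin_coeff_def sum_distrib_left distrib_left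
        del: of_nat_Suc)
  also have "\<dots> = integral {0..2*pi} (\<lambda>s. F s * (1 / 2)) +
       integral {0..2*pi} (\<lambda>s. \<Sum>n<N. F s * cos (real (Suc n) * (s - t)))"
    unfolding term_eq by (subst integral_sum) (auto intro: int_shift simp del: of_nat_Suc)
  also have "\<dots> = integral {0..2*pi} (\<lambda>s. F s * (1 / 2) + (\<Sum>n<N. F s * cos (real (Suc n) * (s - t))))"
    by (intro integral_add[symmetric] integrable_sum int_shift int continuous_intros) auto
  also have "\<dots> = integral {0..2*pi} ?G"
    by (simp add: dirichlet_kernel_def distrib_left sum_distrib_left)
  also have "\<dots> = integral {(t-pi)..(t-pi)+2*pi} ?G"
  proof (rule integral_over_period[symmetric])
    have "dirichlet_kernel N (s + 2 * pi - t) = dirichlet_kernel N (s - t)" for s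
    proof -
      have "cos (real (Suc n) * (s + 2 * pi - t)) = cos (real (Suc n) * (s - t))" for n
      proof -
        have "real (Suc n) * (s + 2 * pi - t) = real (Suc n) * (s - t) + 2 * real (Suc n) * pi"
          by (simp add: algebra_simps)
        then show ?thesis
          by (simp only: cos_add cos_2npi sin_2npi)
      qed
      then show ?thesis by (simp add: dirichlet_kernel_def del: of_nat_Suc)
    qed
    then show "?G (s + 2 * pi) = ?G s" for s
      by (simp add: per)
  qed (use intG in auto)
  also have "\<dots> = integral {t-pi..t} ?G + integral {t..t+pi} ?G"
    by (subst Henstock_Kurzweil_Integration.integral_combine[of _ t]) (auto intro: intG simp: algebra_simps)
  also have "integral {t..t+pi} ?G = integral {0..pi} (\<lambda>u. F (t + u) * dirichlet_kernel N u)"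
    using integral_shift_Icc_real[of 0 pi ?G t] by (simp add: o_def add.commute)
  also have "integral {t-pi..t} ?G = integral {0..pi} (\<lambda>u. F (t - u) * dirichlet_kernel N u)"
  proof -
    have "integral {t-pi..t} ?G = integral {-pi..0} (?G \<circ> (+) t)"
      using integral_shift_Icc_real[of "-pi" 0 ?G t] by simp
    also have "\<dots> = integral {-0..-(-pi)} (\<lambda>u. (?G \<circ> (+) t) (- u))"
      by (rule Henstock_Kurzweil_Integration.integral_reflect_real[symmetric])
    finally show ?thesis
      by (simp add: o_def dirichlet_kernel_def)
  qed
  finally show ?thesis
    by (simp add: field_simps)
qed

text \<open>
  Each half of the convolution tends to half the value at \<open>t\<close>: the kernel has integral \<open>pi / 2\<close> over
  \<open>{0..pi}\<close>, and the remainder \<open>F (t \<plusminus> u) - F t\<close> vanishes at \<open>0\<close> because \<open>F\<close> is continuous at \<open>t\<close>.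
\<close>

lemma fourier_series_at_continuity_point:
  fixes F :: "real \<Rightarrow> real"
  assumes pm: "piecewise_monotone F" and bdd: "bounded (range F)"
    and per: "\<And>s. F (s + 2 * pi) = F s" and cont: "isCont F t"
  shows "(\<lambda>N. fourier_cos_coeff 1 F 0 / 2 + (\<Sum>n<N. fourier_cos_coeff 1 F (Suc n) * cos (real (Suc n) * t)
       + fourier_sin_coeff 1 F (Suc n) * sin (real (Suc n) * t))) \<longlonglongrightarrow> F t"
proof -
  let ?D = dirichlet_kernel
  \<comment> \<open>the sign \<open>k = 1\<close> or \<open>k = - 1\<close> selects the side of \<open>t\<close>\<close>
  have half: "(\<lambda>N. integral {0..pi} (\<lambda>u. F (t + k * u) * ?D N u)) \<longlonglongrightarrow> pi / 2 * F t" if "k \<noteq> 0" for k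
  proof -
    let ?h = "\<lambda>u. F (t + k * u) - F t"
    have pm_h: "piecewise_monotone ?h"
      by (rule piecewise_monotone_affine[OF pm that])
    have bdd_h: "bounded (range ?h)"
    proof -
      obtain M where "\<And>x. \<bar>F x\<bar> \<le> M" using bdd by (auto simp: bounded_iff)
      then have "\<bar>?h u\<bar> \<le> M + M" for u
        by (intro order_trans[OF abs_triangle_ineq4] add_mono)
      then show ?thesis by (auto simp: bounded_iff)
    qed
    have "isCont (\<lambda>u. F (t + k * u)) 0"
      by (rule isCont_o2[where g = F]) (use cont in auto)
    then have "(?h \<longlongrightarrow> 0) (at 0)"
      using tendsto_diff[of "\<lambda>u. F (t + k * u)" "F t" "at 0" "\<lambda>_. F t" "F t"] by (simp add: isCont_def)
    then have "(?h \<longlongrightarrow> 0) (at_right 0)"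
      by (rule tendsto_within_subset) auto
    from tendsto_add[OF dirichlet_kernel_localization[OF pm_h bdd_h this] tendsto_const]
    have "(\<lambda>N. integral {0..pi} (\<lambda>u. ?h u * ?D N u) + pi / 2 * F t) \<longlonglongrightarrow> 0 + pi / 2 * F t" .
    moreover have "integral {0..pi} (\<lambda>u. ?h u * ?D N u) + pi / 2 * F t = integral {0..pi} (\<lambda>u. F (t + k * u) * ?D N u)" for N
    proof -
      have "((\<lambda>u. ?h u * ?D N u + ?D N u * F t) has_integral
          (integral {0..pi} (\<lambda>u. ?h u * ?D N u) + pi / 2 * F t)) {0..pi}"
        by (intro has_integral_add has_integral_mult_left dirichlet_kernel_has_integral integrable_integral
            piecewise_monotone_mult_integrable pm_h bdd_h integrable_dirichlet_kernel)
      then show ?thesis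
        by (simp add: algebra_simps integral_unique)
    qed
    ultimately show ?thesis by simp
  qed
  have "(\<lambda>N. 1 / pi * (integral {0..pi} (\<lambda>u. F (t + 1 * u) * ?D N u) + integral {0..pi} (\<lambda>u. F (t + (-1) * u) * ?D N u)))
     \<longlonglongrightarrow> 1 / pi * (pi / 2 * F t + pi / 2 * F t)"
    by (intro tendsto_intros half) auto
  moreover have "(\<lambda>s. F s * K s) integrable_on {c..d}" if "continuous_on UNIV K" for c d K
    by (intro piecewise_monotone_mult_integrable pm bdd integrable_continuous_real continuous_on_subset[OF that]) auto
  ultimately show ?thesis
    by (simp add: fourier_partial_sum_eq[where F=F, OF _ per] del: of_nat_Suc)
qed

section \<open>Consequences of the Dirichlet conditions\<close>

text \<open>
  A connected subset of the line is an interval, so on either side of \<open>t\<close> it is eventually everything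
  or eventually nothing; a finite union inherits the alternative.
\<close>

lemma finite_components_eventually:
  fixes S :: "real set"
  assumes "finite (components S)"
  shows "(\<forall>\<^sub>F s in at_right t. s \<in> S) \<or> (\<forall>\<^sub>F s in at_right t. s \<notin> S)"
    and "(\<forall>\<^sub>F s in at_left t. s \<in> S) \<or> (\<forall>\<^sub>F s in at_left t. s \<notin> S)"
proof -
  have union: "(\<forall>\<^sub>F s in F. s \<in> S) \<or> (\<forall>\<^sub>F s in F. s \<notin> S)"
    if C: "\<And>C. connected C \<Longrightarrow> (\<forall>\<^sub>F s in F. s \<in> C) \<or> (\<forall>\<^sub>F s in F. s \<notin> C)" for F
  proof (cases "\<exists>C\<in>components S. \<forall>\<^sub>F s in F. s \<in> C")
    case True
    then obtain C where "C \<in> components S" "\<forall>\<^sub>F s in F. s \<in> C" by blast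
    then have "\<forall>\<^sub>F s in F. s \<in> S"
      using in_components_subset by (auto elim!: eventually_mono)
    then show ?thesis ..
  next
    case False
    then have "\<forall>\<^sub>F s in F. s \<notin> C" if "C \<in> components S" for C
      using C[OF in_components_connected[OF that]] that by blast
    then have "\<forall>\<^sub>F s in F. \<forall>C\<in>components S. s \<notin> C"
      by (intro eventually_ball_finite assms) blast
    then have "\<forall>\<^sub>F s in F. s \<notin> S"
      by eventually_elim (use Union_components[of S] in blast)
    then show ?thesis ..
  qed
  show "(\<forall>\<^sub>F s in at_right t. s \<in> S) \<or> (\<forall>\<^sub>F s in at_right t. s \<notin> S)"
  proof (rule union)
    fix C :: "real set" assume "connected C"
    show "(\<forall>\<^sub>F s in at_right t. s \<in> C) \<or> (\<forall>\<^sub>F s in at_right t. s \<notin> C)"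
    proof (cases "\<exists>b>t. \<forall>s>t. s < b \<longrightarrow> s \<notin> C")
      case False
      then obtain b where b: "b > t" "b \<in> C"
        by (metis less_add_one)
      have "s \<in> C" if "t < s" "s < b" for s
      proof -
        obtain r where "t < r" "r < s" "r \<in> C" using False \<open>t < s\<close> by blast
        then show ?thesis
          using connectedD_interval[OF \<open>connected C\<close>, of r b s] b that by auto
      qed
      then show ?thesis
        using b(1) by (auto simp: eventually_at_right_field)
    qed (auto simp: eventually_at_right_field)
  qed
  show "(\<forall>\<^sub>F s in at_left t. s \<in> S) \<or> (\<forall>\<^sub>F s in at_left t. s \<notin> S)"
  proof (rule union)
    fix C :: "real set" assume "connected C"
    show "(\<forall>\<^sub>F s in at_left t. s \<in> C) \<or> (\<forall>\<^sub>F s in at_left t. s \<notin> C)"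
    proof (cases "\<exists>b<t. \<forall>s<t. b < s \<longrightarrow> s \<notin> C")
      case False
      then obtain b where b: "b < t" "b \<in> C"
        by (metis lt_ex)
      have "s \<in> C" if "s < t" "b < s" for s
      proof -
        obtain r where "r < t" "s < r" "r \<in> C" using False \<open>s < t\<close> by blast
        then show ?thesis
          using connectedD_interval[OF \<open>connected C\<close>, of b r s] b that by auto
      qed
      then show ?thesis
        using b(1) by (auto simp: eventually_at_left_field)
    qed (auto simp: eventually_at_left_field)
  qed
qed

text \<open>
  If \<open>f x < f y\<close> with \<open>x < y\<close>, the last point of \<open>{x..y}\<close> at which \<open>f\<close> is at most \<open>f x\<close> is followed by
  strictly larger values and cannot be a local maximum.
\<close>

lemma antimono_on_if_all_local_max:
  fixes f :: "real \<Rightarrow> real"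
  assumes cont: "continuous_on {c<..<d} f" and max: "\<And>x. x \<in> {c<..<d} \<Longrightarrow> local_max_point f x"
  shows "antimono_on {c<..<d} f"
proof (rule monotone_onI)
  fix x y assume xy: "x \<in> {c<..<d}" "y \<in> {c<..<d}" "x \<le> y"
  show "f y \<le> f x"
  proof (rule ccontr)
    assume "\<not> f y \<le> f x"
    let ?S = "{s \<in> {x..y}. f s \<le> f x}"
    have "continuous_on {x..y} f"
      by (rule continuous_on_subset[OF cont]) (use xy in auto)
    then have "closed ?S"
      using continuous_on_closed_Collect_le[of "{x..y}" f "\<lambda>_. f x"] by (simp add: continuous_on_const)
    then have "compact ?S"
      using compact_Int_closed[of "{x..y}" ?S] by (simp add: Int_def conj_ac)
    moreover have "x \<in> ?S" using xy by auto
    ultimately obtain s where s: "s \<in> ?S" "\<And>r. r \<in> ?S \<Longrightarrow> r \<le> s"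
      using compact_attains_sup[of ?S] by blast
    have "s < y"
      using s(1) \<open>\<not> f y \<le> f x\<close> by (cases "s = y") auto
    have "\<forall>\<^sub>F r in at_right s. f r \<le> f s"
      using max[of s] s(1) xy unfolding local_max_point_def
      by (auto simp: eventually_at_filter elim!: eventually_mono)
    moreover have "\<forall>\<^sub>F r in at_right s. r < y"
      using \<open>s < y\<close> by (auto simp: eventually_at_right_field)
    ultimately have "\<forall>\<^sub>F r in at_right s. f r \<le> f s \<and> r < y \<and> s < r"
      by (auto simp: eventually_conj_iff eventually_at_right_less)
    then obtain r where "f r \<le> f s" "r < y" "s < r"
      using eventually_happens' trivial_limit_at_right_real by blast
    with s(1) s(2)[of r] show False by auto
  qed
qed

lemma local_min_point_iff: "local_min_point f t \<longleftrightarrow> local_max_point (\<lambda>s. - f s) t"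
  by (simp add: local_min_point_def local_max_point_def)

text \<open>
  If there is no local extremum at all, \<open>f\<close> is injective: between two points with equal values
  a continuous function attains an interior maximum or minimum.  A continuous injective function on an
  interval is strictly monotone.
\<close>

lemma monotone_if_extrema_all_or_none:
  fixes f :: "real \<Rightarrow> real"
  assumes cont: "continuous_on {c<..<d} f"
    and max: "(\<forall>x\<in>{c<..<d}. local_max_point f x) \<or> (\<forall>x\<in>{c<..<d}. \<not> local_max_point f x)"
    and min: "(\<forall>x\<in>{c<..<d}. local_min_point f x) \<or> (\<forall>x\<in>{c<..<d}. \<not> local_min_point f x)"
  shows "mono_on {c<..<d} f \<or> antimono_on {c<..<d} f"
proof -
  consider "\<forall>x\<in>{c<..<d}. local_max_point f x" | "\<forall>x\<in>{c<..<d}. local_min_point f x"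
    | "\<forall>x\<in>{c<..<d}. \<not> local_max_point f x \<and> \<not> local_min_point f x"
    using max min by blast
  then show ?thesis
  proof cases
    case 1
    then show ?thesis using antimono_on_if_all_local_max[OF cont] by blast
  next
    case 2
    then have "antimono_on {c<..<d} (\<lambda>x. - f x)"
      by (intro antimono_on_if_all_local_max continuous_on_minus cont) (simp add: local_min_point_iff)
    then show ?thesis by (auto simp: monotone_on_def)
  next
    case 3
    have "f x \<noteq> f y" if xy: "x \<in> {c<..<d}" "y \<in> {c<..<d}" "x < y" for x y
    proof
      assume eq: "f x = f y"
      have contxy: "continuous_on {x..y} f"
        by (rule continuous_on_subset[OF cont]) (use xy in auto)
      have nhds: "\<forall>\<^sub>F r in nhds z. r \<in> {x..y}" if "x < z" "z < y" for z
        using eventually_nhds_in_open[of "{x<..<y}" z] that by (auto elim!: eventually_mono)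
      obtain u where u: "u \<in> {x..y}" "\<And>r. r \<in> {x..y} \<Longrightarrow> f r \<le> f u"
        using continuous_attains_sup[OF _ _ contxy] xy by auto
      obtain v where v: "v \<in> {x..y}" "\<And>r. r \<in> {x..y} \<Longrightarrow> f v \<le> f r"
        using continuous_attains_inf[OF _ _ contxy] xy by auto
      have "\<not> (x < u \<and> u < y)"
      proof
        assume "x < u \<and> u < y"
        then have "local_max_point f u"
          using nhds[of u] u(2) unfolding local_max_point_def by (auto elim!: eventually_mono)
        with 3 u(1) xy show False by auto
      qed
      then have fu: "f u = f x" using u(1) eq by (cases "u = x") (auto simp: not_less)
      \<comment> \<open>if also the minimum is the common endpoint value, \<open>f\<close> is constant on \<open>{x..y}\<close>\<close>
      have "local_max_point f ((x + y) / 2)" if "f v = f x"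
      proof -
        let ?m = "(x + y) / 2"
        have m: "x < ?m" "?m < y" using xy(3) by (simp_all add: field_simps)
        have "f r \<le> f ?m" if "r \<in> {x..y}" for r
          using u(2)[OF that] v(2)[of ?m] m fu \<open>f v = f x\<close> by simp
        then show ?thesis
          using nhds[OF m] unfolding local_max_point_def by (auto elim!: eventually_mono)
      qed
      moreover have "(x + y) / 2 \<in> {c<..<d}" "f v \<le> f x"
        using xy v(2)[of x] by (auto simp: field_simps)
      ultimately have "f v < f x"
        using 3 by (meson order_le_imp_less_or_eq)
      then have "v \<noteq> x" "v \<noteq> y" using eq by auto
      then have "x < v \<and> v < y" using v(1) by auto
      then have "local_min_point f v"
        using nhds[of v] v(2) unfolding local_min_point_def by (auto elim!: eventually_mono)
      with 3 v(1) xy show False by auto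
    qed
    then have "inj_on f {c<..<d}"
      by (metis (no_types, lifting) inj_onI linorder_neqE_linordered_idom)
    then have "strict_mono_on {c<..<d} f \<or> monotone_on {c<..<d} (<) (>) f"
      using injective_eq_monotone_map[OF _ cont] by (simp add: is_interval_oo)
    then show ?thesis
      by (auto simp: monotone_on_def order_le_less)
  qed
qed

lemma periodic_of_int:
  fixes f :: "real \<Rightarrow> 'a"
  assumes "\<And>t. f (t + T) = f t"
  shows "f (t + of_int k * T) = f t"
proof -
  have nat: "f (t + of_nat n * T) = f t" for n t
  proof (induction n)
    case (Suc n)
    have "t + of_nat (Suc n) * T = (t + of_nat n * T) + T" by (simp add: algebra_simps)
    then show ?case using Suc assms by metis
  qed simp
  show ?thesis
  proof (cases "k \<ge> 0")
    case True
    then show ?thesis using nat[of t "nat k"] by simp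
  next
    case False
    then show ?thesis using nat[of "t + of_int k * T" "nat (-k)"] by simp
  qed
qed

lemma isCont_periodic_iff:
  fixes f :: "real \<Rightarrow> real"
  assumes "\<And>t. f (t + T) = f t"
  shows "isCont f (t + of_int k * T) \<longleftrightarrow> isCont f t"
proof -
  have "f (t + of_int k * T + h) = f (t + h)" for h
    using periodic_of_int[where f=f and T=T, OF assms, of "t + h" k] by (simp add: ac_simps)
  then show ?thesis
    using periodic_of_int[where f=f and T=T, OF assms, of t k] by (simp add: isCont_iff)
qed

lemma finite_discontinuities_on_intervals:
  fixes f :: "real \<Rightarrow> real"
  assumes "T > 0" and per: "\<And>t. f (t + T) = f t" and fin: "finite {t \<in> {0..<T}. \<not> isCont f t}"
  shows "finite {t \<in> {c..d}. \<not> isCont f t}"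
proof (rule finite_subset)
  show "{t \<in> {c..d}. \<not> isCont f t} \<subseteq>
    (\<Union>k\<in>{\<lfloor>c / T\<rfloor>..\<lfloor>d / T\<rfloor>}. (\<lambda>s. s + of_int k * T) ` {t \<in> {0..<T}. \<not> isCont f t})"
  proof safe
    fix t assume t: "t \<in> {c..d}" "\<not> isCont f t"
    let ?k = "\<lfloor>t / T\<rfloor>"
    have "of_int ?k * T \<le> t" "t < of_int ?k * T + T"
      using floor_divide_lower[OF \<open>T > 0\<close>, of t] floor_divide_upper[OF \<open>T > 0\<close>, of t]
      by (auto simp: distrib_right)
    moreover have "\<not> isCont f (t - of_int ?k * T)"
      using isCont_periodic_iff[where f=f and T=T, OF per, of "t - of_int ?k * T" ?k] t by simp
    moreover have "?k \<in> {\<lfloor>c / T\<rfloor>..\<lfloor>d / T\<rfloor>}"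
      using t \<open>T > 0\<close> by (auto intro!: floor_mono divide_right_mono)
    ultimately show "t \<in> (\<Union>k\<in>{\<lfloor>c / T\<rfloor>..\<lfloor>d / T\<rfloor>}. (\<lambda>s. s + of_int k * T) ` {t \<in> {0..<T}. \<not> isCont f t})"
      by (intro UN_I[of ?k] image_eqI[of _ _ "t - of_int ?k * T"]) auto
  qed
qed (use fin in auto)

lemma eventually_isCont_if_finite_discontinuities:
  fixes f :: "real \<Rightarrow> real"
  assumes "finite {s \<in> {t-1..t+1}. \<not> isCont f s}"
  shows "\<forall>\<^sub>F s in at t. isCont f s"
proof -
  obtain e where e: "e > 0" "\<And>s. s \<in> {s \<in> {t-1..t+1}. \<not> isCont f s} \<Longrightarrow> s \<noteq> t \<Longrightarrow> e \<le> dist t s"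
    using finite_set_avoid[OF assms, of t] by blast
  then have "isCont f s" if "s \<noteq> t" "dist s t < min e 1" for s
    using that e(2)[of s] by (fastforce simp: dist_real_def)
  then show ?thesis
    using \<open>e > 0\<close> unfolding eventually_at by (intro exI[of _ "min e 1"]) auto
qed

lemma bounded_range_periodic:
  fixes f :: "real \<Rightarrow> real"
  assumes "T > 0" and per: "\<And>t. f (t + T) = f t" and "bounded (f ` {0..<T})"
  shows "bounded (range f)"
proof (rule bounded_subset[OF \<open>bounded (f ` {0..<T})\<close>])
  show "range f \<subseteq> f ` {0..<T}"
  proof safe
    fix t
    let ?k = "\<lfloor>t / T\<rfloor>"
    have "t - of_int ?k * T \<in> {0..<T}"
      using floor_divide_lower[OF \<open>T > 0\<close>, of t] floor_divide_upper[OF \<open>T > 0\<close>, of t]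
      by (auto simp: distrib_right)
    moreover have "f t = f (t - of_int ?k * T)"
      using periodic_of_int[where f=f and T=T, OF per, of "t - of_int ?k * T" ?k] by simp
    ultimately show "f t \<in> f ` {0..<T}" by blast
  qed
qed

lemma monotone_on_translate:
  fixes f :: "real \<Rightarrow> real"
  assumes "\<And>s. f (s + a) = f s"
    and "mono_on {c<..<d} f \<or> antimono_on {c<..<d} f"
  shows "mono_on {c+a<..<d+a} f \<or> antimono_on {c+a<..<d+a} f"
proof -
  have *: "f s = f (s - a)" for s using assms(1)[of "s - a"] by simp
  from assms(2) show ?thesis
  proof (elim disjE)
    assume m: "mono_on {c<..<d} f"
    have "mono_on {c+a<..<d+a} f"
      by (rule monotone_onI, subst (1 2) *, rule monotone_onD[OF m]) auto
    then show ?thesis ..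
  next
    assume m: "antimono_on {c<..<d} f"
    have "antimono_on {c+a<..<d+a} f"
      by (rule monotone_onI, subst (1 2) *, rule monotone_onD[OF m]) auto
    then show ?thesis ..
  qed
qed

text \<open>
  Near each point and on either side of it, \<open>f\<close> is continuous, and either all points or no points are
  local maxima, and likewise for minima.  The extrema are only counted in \<open>{0..<T}\<close>, which is a right
  neighbourhood of each of its points but a left neighbourhood only of the points of \<open>{0<..T}\<close>; hence
  the two different translations into a period, with the floor and with the ceiling.
\<close>

lemma dirichlet_conditions_piecewise_monotone:
  fixes f :: "real \<Rightarrow> real"
  assumes "T > 0" and per: "\<And>t. f (t + T) = f t" and dir: "dirichlet_conditions T f"
  shows "piecewise_monotone f"
proof -
  define A where "A = {t \<in> {0..<T}. local_max_point f t}"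
  define B where "B = {t \<in> {0..<T}. local_min_point f t}"
  have fin: "finite (components A)" "finite (components B)"
    using dir by (auto simp: dirichlet_conditions_def A_def B_def)
  have cont: "\<forall>\<^sub>F s in at t. isCont f s" for t
    using dir unfolding dirichlet_conditions_def
    by (intro eventually_isCont_if_finite_discontinuities finite_discontinuities_on_intervals[where T=T, OF \<open>T > 0\<close>] per) auto
  have interval: "mono_on {c<..<d} f \<or> antimono_on {c<..<d} f"
    if sub: "{c<..<d} \<subseteq> {0..<T}" and ct: "\<And>s. s \<in> {c<..<d} \<Longrightarrow> isCont f s"
      and AB: "(\<forall>s\<in>{c<..<d}. s \<in> A) \<or> (\<forall>s\<in>{c<..<d}. s \<notin> A)"
        "(\<forall>s\<in>{c<..<d}. s \<in> B) \<or> (\<forall>s\<in>{c<..<d}. s \<notin> B)" for c d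
  proof (rule monotone_if_extrema_all_or_none)
    show "continuous_on {c<..<d} f"
      using ct by (intro continuous_at_imp_continuous_on) auto
    show "(\<forall>x\<in>{c<..<d}. local_max_point f x) \<or> (\<forall>x\<in>{c<..<d}. \<not> local_max_point f x)"
      using AB(1) sub unfolding A_def by blast
    show "(\<forall>x\<in>{c<..<d}. local_min_point f x) \<or> (\<forall>x\<in>{c<..<d}. \<not> local_min_point f x)"
      using AB(2) sub unfolding B_def by blast
  qed
  have right: "\<exists>b>t. mono_on {t<..<b} f \<or> antimono_on {t<..<b} f" if "t \<in> {0..<T}" for t
  proof -
    have sub: "\<forall>\<^sub>F s in at_right t. s \<in> {0..<T}"
      using that by (auto simp: eventually_at_right_field)
    have ct: "\<forall>\<^sub>F s in at_right t. isCont f s"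
      using filter_leD[OF at_le[OF subset_UNIV] cont] .
    obtain a where a: "\<forall>\<^sub>F s in at_right t. (s \<in> A) = a"
      using finite_components_eventually(1)[OF fin(1), of t] that[of True] that[of False] by auto
    obtain b where b: "\<forall>\<^sub>F s in at_right t. (s \<in> B) = b"
      using finite_components_eventually(1)[OF fin(2), of t] that[of True] that[of False] by auto
    have "\<forall>\<^sub>F s in at_right t. s \<in> {0..<T} \<and> isCont f s \<and> (s \<in> A) = a \<and> (s \<in> B) = b"
      using sub ct a b by eventually_elim auto
    then obtain r where r: "r > t" "\<And>s. t < s \<Longrightarrow> s < r \<Longrightarrow> s \<in> {0..<T} \<and> isCont f s \<and> (s \<in> A) = a \<and> (s \<in> B) = b"
      unfolding eventually_at_right_field by blast
    have "mono_on {t<..<r} f \<or> antimono_on {t<..<r} f"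
      by (rule interval) (use r(2) in \<open>auto simp: subset_iff\<close>)
    with \<open>r > t\<close> show ?thesis by blast
  qed
  have left: "\<exists>b<t. mono_on {b<..<t} f \<or> antimono_on {b<..<t} f" if "t \<in> {0<..T}" for t
  proof -
    have sub: "\<forall>\<^sub>F s in at_left t. s \<in> {0..<T}"
      using that by (auto simp: eventually_at_left_field intro!: exI[of _ 0])
    have ct: "\<forall>\<^sub>F s in at_left t. isCont f s"
      using filter_leD[OF at_le[OF subset_UNIV] cont] .
    obtain a where a: "\<forall>\<^sub>F s in at_left t. (s \<in> A) = a"
      using finite_components_eventually(2)[OF fin(1), of t] that[of True] that[of False] by auto
    obtain b where b: "\<forall>\<^sub>F s in at_left t. (s \<in> B) = b"
      using finite_components_eventually(2)[OF fin(2), of t] that[of True] that[of False] by auto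
    have "\<forall>\<^sub>F s in at_left t. s \<in> {0..<T} \<and> isCont f s \<and> (s \<in> A) = a \<and> (s \<in> B) = b"
      using sub ct a b by eventually_elim auto
    then obtain r where r: "r < t" "\<And>s. r < s \<Longrightarrow> s < t \<Longrightarrow> s \<in> {0..<T} \<and> isCont f s \<and> (s \<in> A) = a \<and> (s \<in> B) = b"
      unfolding eventually_at_left_field by blast
    have "mono_on {r<..<t} f \<or> antimono_on {r<..<t} f"
      by (rule interval) (use r(2) in \<open>auto simp: subset_iff\<close>)
    with \<open>r < t\<close> show ?thesis by blast
  qed
  show ?thesis
    unfolding piecewise_monotone_def
  proof
    fix t
    let ?k = "\<lfloor>t / T\<rfloor>" and ?l = "\<lceil>t / T\<rceil> - 1"
    have per_int: "f (s + of_int k * T) = f s" for s k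
      using periodic_of_int[where f=f and T=T, OF per] by simp
    have "t - of_int ?k * T \<in> {0..<T}"
      using floor_divide_lower[OF \<open>T > 0\<close>, of t] floor_divide_upper[OF \<open>T > 0\<close>, of t]
      by (auto simp: distrib_right)
    from right[OF this] obtain b where b: "b > t - of_int ?k * T"
      "mono_on {t - of_int ?k * T<..<b} f \<or> antimono_on {t - of_int ?k * T<..<b} f" by blast
    have R: "mono_on {t<..<b + of_int ?k * T} f \<or> antimono_on {t<..<b + of_int ?k * T} f"
      using monotone_on_translate[OF per_int[where k="?k"] b(2)] by simp
    have "t - of_int ?l * T \<in> {0<..T}"
      using ceiling_divide_lower[OF \<open>T > 0\<close>, of t] ceiling_divide_upper[OF \<open>T > 0\<close>, of t]
      by (auto simp: algebra_simps)
    from left[OF this] obtain a where a: "a < t - of_int ?l * T"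
      "mono_on {a<..<t - of_int ?l * T} f \<or> antimono_on {a<..<t - of_int ?l * T} f" by blast
    have L: "mono_on {a + of_int ?l * T<..<t} f \<or> antimono_on {a + of_int ?l * T<..<t} f"
      using monotone_on_translate[OF per_int[where k="?l"] a(2)] by simp
    define \<delta> where "\<delta> = min (b + of_int ?k * T - t) (t - (a + of_int ?l * T))"
    have "{t<..<t+\<delta>} \<subseteq> {t<..<b + of_int ?k * T}" "{t-\<delta><..<t} \<subseteq> {a + of_int ?l * T<..<t}"
      unfolding \<delta>_def by auto
    moreover have "\<delta> > 0" using a(1) b(1) by (auto simp: \<delta>_def)
    ultimately show "\<exists>\<delta>>0. (mono_on {t<..<t+\<delta>} f \<or> antimono_on {t<..<t+\<delta>} f) \<and>
     (mono_on {t-\<delta><..<t} f \<or> antimono_on {t-\<delta><..<t} f)"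
      using R L by (meson monotone_on_subset)
  qed
qed

text \<open>Rescaling time to period \<open>2 * pi\<close> preserves the coefficients, and the zero mean removes the constant term.\<close>

lemma trig_series_at_continuity_point:
  fixes f :: "real \<Rightarrow> real"
  assumes "\<omega> > 0" and per: "\<And>t. f (t + 2 * pi / \<omega>) = f t"
    and dir: "dirichlet_conditions (2 * pi / \<omega>) f"
    and mean: "integral {0..2 * pi / \<omega>} f = 0" and cont: "isCont f t"
  shows "trig_series \<omega> (fourier_cos_coeff \<omega> f) (fourier_sin_coeff \<omega> f) t = f t"
proof -
  let ?F = "\<lambda>u. f (0 + (1 / \<omega>) * u) - 0"
  have T: "2 * pi / \<omega> > 0" using \<open>\<omega> > 0\<close> by simp
  have pm: "piecewise_monotone ?F"
    by (rule piecewise_monotone_affine[OF dirichlet_conditions_piecewise_monotone[OF T per dir]])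
      (use \<open>\<omega> > 0\<close> in auto)
  have bdd: "bounded (range ?F)"
    by (rule bounded_subset[OF bounded_range_periodic[where f=f, OF T per]])
      (use dir in \<open>auto simp: dirichlet_conditions_def\<close>)
  have perF: "?F (u + 2 * pi) = ?F u" for u
    using per[of "u / \<omega>"] by (simp add: add_divide_distrib)
  have contF: "isCont ?F (\<omega> * t)"
    by (rule isCont_o2[where g = f and f = "\<lambda>u. 0 + 1 / \<omega> * u", THEN continuous_diff, OF _ _ continuous_const])
      (use cont \<open>\<omega> > 0\<close> in auto)
  have scale: "integral {0..2*pi} (\<lambda>u. h (u / \<omega>)) = \<omega> * integral {0..2 * pi / \<omega>} h" for h :: "real \<Rightarrow> real"
  proof -
    have "integral {0..2*pi} (\<lambda>u. h (u / \<omega>)) / \<omega> = integral {0..2 * pi / \<omega>} h"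
      using integral_stretch_real[of \<omega> 0 "2 * pi" "\<lambda>u. h (u / \<omega>)"] \<open>\<omega> > 0\<close> by simp
    then show ?thesis using \<open>\<omega> > 0\<close> by (simp add: field_simps)
  qed
  have cosF: "fourier_cos_coeff 1 ?F n = fourier_cos_coeff \<omega> f n" for n
    using scale[of "\<lambda>s. f s * cos (real n * \<omega> * s)"] \<open>\<omega> > 0\<close> by (simp add: fourier_cos_coeff_def)
  have sinF: "fourier_sin_coeff 1 ?F n = fourier_sin_coeff \<omega> f n" for n
    using scale[of "\<lambda>s. f s * sin (real n * \<omega> * s)"] \<open>\<omega> > 0\<close> by (simp add: fourier_sin_coeff_def)
  have "fourier_cos_coeff \<omega> f 0 = 0"
    using mean by (simp add: fourier_cos_coeff_def)
  then have "(\<lambda>n. fourier_cos_coeff \<omega> f (Suc n) * cos (real (Suc n) * \<omega> * t)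
      + fourier_sin_coeff \<omega> f (Suc n) * sin (real (Suc n) * \<omega> * t)) sums f t"
    using fourier_series_at_continuity_point[where F = ?F, OF pm bdd perF contF] \<open>\<omega> > 0\<close>
    unfolding cosF sinF sums_def by (simp add: mult.assoc del: of_nat_Suc)
  then show ?thesis
    unfolding trig_series_def by (simp add: sums_iff del: of_nat_Suc)
qed

section \<open>The oscillator with nonresonant periodic forcing\<close>

text \<open>
  Away from its jumps the forcing determines the derivative of the solution; this lemma extends
  differentiability across the jumps.  A continuous function is the integral of its derivative even if
  finitely many points are exceptional, and the integral of a continuous function is differentiable
  everywhere.
\<close>

lemma has_real_derivative_if_finite_exceptions:
  fixes G u :: "real \<Rightarrow> real"
  assumes contG: "continuous_on UNIV G" and contu: "continuous_on UNIV u"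
    and fin: "finite {s \<in> {t-1..t+1}. \<not> (G has_real_derivative u s) (at s)}"
  shows "(G has_real_derivative u t) (at t)"
proof -
  let ?E = "{s \<in> {t-1..t+1}. \<not> (G has_real_derivative u s) (at s)}"
  have G: "integral {t-1..x} u + G (t-1) = G x" if "x \<in> {t-1..t+1}" for x
  proof -
    have "(u has_integral (G x - G (t-1))) {t-1..x}"
    proof (rule fundamental_theorem_of_calculus_interior_strong[OF fin])
      show "(G has_vector_derivative u s) (at s)" if "s \<in> {t-1<..<x} - ?E" for s
        using that \<open>x \<in> {t-1..t+1}\<close> by (auto simp flip: has_real_derivative_iff_has_vector_derivative)
    qed (use that in \<open>auto intro: continuous_on_subset[OF contG]\<close>)
    then show ?thesis by (simp add: integral_unique)
  qed
  have "((\<lambda>x. integral {t-1..x} u) has_real_derivative u t) (at t within {t-1..t+1})"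
    by (rule integral_has_real_derivative) (auto intro: continuous_on_subset[OF contu])
  then have "((\<lambda>x. integral {t-1..x} u) has_real_derivative u t) (at t within {t-1<..<t+1})"
    by (rule DERIV_subset) auto
  then have "((\<lambda>x. integral {t-1..x} u) has_real_derivative u t) (at t)"
    by (simp add: at_within_open[of t "{t-1<..<t+1}"])
  then have "((\<lambda>x. integral {t-1..x} u + G (t-1)) has_real_derivative u t) (at t)"
    by (auto intro!: derivative_eq_intros)
  then show ?thesis
    by (rule has_field_derivative_transform_within_open[where S = "{t-1<..<t+1}"]) (auto simp: G)
qed

text \<open>
  Variation of constants for \<open>y'' + \<omega>\<^sup>2 y = F\<close>.  The coefficient functions \<open>C\<close> and \<open>S\<close> are the primitives of
  \<open>F cos (\<omega> t)\<close> and \<open>F sin (\<omega> t)\<close>; their increments over a period are the first Fourier coefficients of \<open>F\<close>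
  up to a factor.  So \<open>C\<close>, \<open>S\<close> and the solution are periodic exactly because there is no secular term.
\<close>

lemma nonresonant_oscillator_periodic_solution:
  fixes F :: "real \<Rightarrow> real"
  assumes "\<omega> > 0"
    and intC: "\<And>c d. (\<lambda>s. F s * cos (\<omega> * s)) integrable_on {c..d}"
    and intS: "\<And>c d. (\<lambda>s. F s * sin (\<omega> * s)) integrable_on {c..d}"
    and per: "\<And>t. F (t + 2 * pi / \<omega>) = F t"
    and fin: "\<And>c d. finite {t \<in> {c..d}. \<not> isCont F t}"
    and res: "no_secular_terms \<omega> F"
  obtains y u where "\<And>t. y (t + 2 * pi / \<omega>) = y t"
    and "\<And>t. (y has_real_derivative u t) (at t)"
    and "continuous_on UNIV u"
    and "\<And>t. isCont F t \<Longrightarrow> (u has_real_derivative F t - \<omega>\<^sup>2 * y t) (at t)"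
proof -
  define C where "C = primitive (\<lambda>s. F s * cos (\<omega> * s))"
  define S where "S = primitive (\<lambda>s. F s * sin (\<omega> * s))"
  define y where "y t = (sin (\<omega> * t) * C t - cos (\<omega> * t) * S t) / \<omega>" for t
  define u where "u t = cos (\<omega> * t) * C t + sin (\<omega> * t) * S t" for t
  let ?T = "2 * pi / \<omega>"
  have trig_per: "cos (\<omega> * (t + ?T)) = cos (\<omega> * t)" "sin (\<omega> * (t + ?T)) = sin (\<omega> * t)" for t
    using \<open>\<omega> > 0\<close> by (simp_all add: distrib_left)
  have zero: "C ?T = 0" "S ?T = 0"
    using res \<open>\<omega> > 0\<close>
    by (simp_all add: C_def S_def primitive_nonneg no_secular_terms_def fourier_cos_coeff_def
        fourier_sin_coeff_def)
  have "C (t + ?T) - C t = C ?T" "S (t + ?T) - S t = S ?T" for t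
    unfolding C_def S_def
    by (rule primitive_period_increment; use intC intS per trig_per in simp)+
  then have CS_per: "C (t + ?T) = C t" "S (t + ?T) = S t" for t
    using zero by (metis eq_iff_diff_eq_0)+
  have contC: "continuous_on UNIV C" and contS: "continuous_on UNIV S"
    unfolding C_def S_def by (intro continuous_on_primitive intC intS)+
  have contu: "continuous_on UNIV u" and conty: "continuous_on UNIV y"
    unfolding u_def y_def using \<open>\<omega> > 0\<close> by (auto intro!: continuous_intros contC contS)
  have derC: "(C has_real_derivative F t * cos (\<omega> * t)) (at t)"
    and derS: "(S has_real_derivative F t * sin (\<omega> * t)) (at t)" if "isCont F t" for t
    unfolding C_def S_def
    by (rule primitive_has_real_derivative[OF intC] primitive_has_real_derivative[OF intS],
        use that in \<open>auto intro!: continuous_intros\<close>)+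
  \<comment> \<open>the terms with \<open>F t\<close> cancel\<close>
  have dery: "(y has_real_derivative u t) (at t)" if "isCont F t" for t
    unfolding y_def u_def using \<open>\<omega> > 0\<close>
    by (auto intro!: derivative_eq_intros derC derS that simp: field_simps)
  show thesis
  proof (rule that)
    show "y (t + ?T) = y t" for t
      unfolding y_def CS_per trig_per ..
    show "(y has_real_derivative u t) (at t)" for t
      by (rule has_real_derivative_if_finite_exceptions[OF conty contu finite_subset[OF _ fin[of "t-1" "t+1"]]])
        (use dery in auto)
    show "(u has_real_derivative F t - \<omega>\<^sup>2 * y t) (at t)" if "isCont F t" for t
    proof -
      have "(u has_real_derivative
          (F t * cos (\<omega> * t) * cos (\<omega> * t) + - (sin (\<omega> * t) * \<omega>) * C t)
        + (F t * sin (\<omega> * t) * sin (\<omega> * t) + cos (\<omega> * t) * \<omega> * S t)) (at t)"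
        unfolding u_def by (auto intro!: derivative_eq_intros derC derS that)
      then show ?thesis
      proof (rule DERIV_cong)
        have "F t * cos (\<omega> * t) * cos (\<omega> * t) + F t * sin (\<omega> * t) * sin (\<omega> * t) = F t"
          by (metis distrib_left mult.assoc mult.right_neutral power2_eq_square sin_cos_squared_add2)
        moreover have "\<omega>\<^sup>2 * y t = \<omega> * (sin (\<omega> * t) * C t - cos (\<omega> * t) * S t)"
          unfolding y_def using \<open>\<omega> > 0\<close> by (simp add: power2_eq_square)
        ultimately show "F t * cos (\<omega> * t) * cos (\<omega> * t) + - (sin (\<omega> * t) * \<omega>) * C t +
            (F t * sin (\<omega> * t) * sin (\<omega> * t) + cos (\<omega> * t) * \<omega> * S t) = F t - \<omega>\<^sup>2 * y t"
          by (simp add: algebra_simps)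
      qed
    qed
  qed (fact contu)
qed

lemma continuous_periodic_bounded:
  fixes y :: "real \<Rightarrow> real"
  assumes "T > 0" "\<And>t. y (t + T) = y t" "continuous_on UNIV y"
  obtains M where "M \<ge> 0" "\<And>t. \<bar>y t\<bar> \<le> M"
proof -
  have "bounded (y ` {0..T})"
    by (intro compact_imp_bounded compact_continuous_image continuous_on_subset[OF assms(3)]) auto
  then have "bounded (y ` {0..<T})"
    by (rule bounded_subset) auto
  from bounded_range_periodic[where f = y, OF assms(1,2) this]
  obtain M where "\<And>t. \<bar>y t\<bar> \<le> M" by (auto simp: bounded_iff)
  moreover from this[of 0] have "M \<ge> 0" by linarith
  ultimately show thesis using that by blast
qed

section \<open>The solvability condition at first order\<close>

lemma has_integral_over_period_by_antiderivative:
  fixes G g :: "real \<Rightarrow> real"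
  assumes "\<omega> > 0" "\<And>\<theta>. (G has_real_derivative g \<theta>) (at \<theta>)"
  shows "((\<lambda>t. g (\<omega> * t)) has_integral (G (2 * pi) - G 0) / \<omega>) {0..2 * pi / \<omega>}"
proof -
  have "((\<lambda>t. G (\<omega> * t) / \<omega>) has_real_derivative g (\<omega> * t)) (at t)" for t
    using \<open>\<omega> > 0\<close> by (auto intro!: derivative_eq_intros assms(2)[THEN DERIV_chain2])
  then have "((\<lambda>t. g (\<omega> * t)) has_integral
      (G (\<omega> * (2 * pi / \<omega>)) / \<omega> - G (\<omega> * 0) / \<omega>)) {0..2 * pi / \<omega>}"
    using \<open>\<omega> > 0\<close>
    by (intro fundamental_theorem_of_calculus)
      (auto simp flip: has_real_derivative_iff_has_vector_derivative intro: has_field_derivative_at_within)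
  then show ?thesis
    using \<open>\<omega> > 0\<close> by (simp add: diff_divide_distrib)
qed

lemma trig_moments_over_period:
  fixes \<omega> :: real
  assumes "\<omega> > 0"
  defines "c \<equiv> \<lambda>t. cos (\<omega> * t)" and "s \<equiv> \<lambda>t. sin (\<omega> * t)" and "I \<equiv> {0..2 * pi / \<omega>}"
  shows "((\<lambda>t. c t ^ 3) has_integral 0) I" "((\<lambda>t. c t ^ 2 * s t) has_integral 0) I"
    "((\<lambda>t. c t * s t ^ 2) has_integral 0) I"
    "((\<lambda>t. c t ^ 4) has_integral 3 * pi / (4 * \<omega>)) I" "((\<lambda>t. c t ^ 3 * s t) has_integral 0) I"
    "((\<lambda>t. c t ^ 2 * s t ^ 2) has_integral pi / (4 * \<omega>)) I"
    "((\<lambda>t. c t * s t ^ 3) has_integral 0) I" "((\<lambda>t. s t ^ 4) has_integral 3 * pi / (4 * \<omega>)) I"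
proof -
  note int = has_integral_over_period_by_antiderivative[OF \<open>\<omega> > 0\<close>]
  note unit = sin_cos_squared_add
  have dsc: "((\<lambda>\<theta>. sin \<theta> * cos \<theta> / 2) has_real_derivative (cos \<theta> ^ 2 - sin \<theta> ^ 2) / 2) (at \<theta>)" for \<theta> :: real
    by (auto intro!: derivative_eq_intros simp: power2_eq_square)
  have dcs: "((\<lambda>\<theta>. cos \<theta> ^ 2 - sin \<theta> ^ 2) has_real_derivative - 4 * (sin \<theta> * cos \<theta>)) (at \<theta>)" for \<theta> :: real
    by (auto intro!: derivative_eq_intros)
  let ?q = "\<lambda>\<theta>::real. \<theta> / 8 - sin \<theta> * cos \<theta> / 2 * (cos \<theta> ^ 2 - sin \<theta> ^ 2) / 4"
  have q: "(?q has_real_derivative cos \<theta> ^ 2 * sin \<theta> ^ 2) (at \<theta>)" for \<theta>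
  proof (rule DERIV_cong[OF DERIV_diff[OF DERIV_cdivide[OF DERIV_ident] DERIV_cdivide[OF DERIV_mult[OF dsc dcs]]]])
    have halve: "d / 2 * d + - 4 * m * (m / 2) = (d ^ 2 - 4 * m ^ 2) / 2" for d m :: real
      by (simp add: power2_eq_square diff_divide_distrib)
    have val: "(cos \<theta> ^ 2 - sin \<theta> ^ 2) ^ 2 - 4 * (sin \<theta> * cos \<theta>) ^ 2 = 1 - 8 * (cos \<theta> ^ 2 * sin \<theta> ^ 2)"
      using unit[of \<theta>] by algebra
    show "1 / 8 - ((cos \<theta> ^ 2 - sin \<theta> ^ 2) / 2 * (cos \<theta> ^ 2 - sin \<theta> ^ 2)
        + - 4 * (sin \<theta> * cos \<theta>) * (sin \<theta> * cos \<theta> / 2)) / 4 = cos \<theta> ^ 2 * sin \<theta> ^ 2"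
      unfolding halve val by (simp add: diff_divide_distrib)
  qed
  show "((\<lambda>t. c t ^ 3) has_integral 0) I"
  proof -
    have "((\<lambda>\<theta>. sin \<theta> - sin \<theta> ^ 3 / 3) has_real_derivative cos \<theta> - sin \<theta> ^ 2 * cos \<theta>) (at \<theta>)" for \<theta> :: real
      by (auto intro!: derivative_eq_intros)
    moreover have "cos \<theta> - sin \<theta> ^ 2 * cos \<theta> = cos \<theta> ^ 3" for \<theta> :: real
      using unit[of \<theta>] by algebra
    ultimately show ?thesis
      using int[of "\<lambda>\<theta>. sin \<theta> - sin \<theta> ^ 3 / 3" "\<lambda>\<theta>. cos \<theta> ^ 3"] unfolding c_def I_def by simp
  qed
  have "((\<lambda>\<theta>. - (cos \<theta> ^ 3) / 3) has_real_derivative cos \<theta> ^ 2 * sin \<theta>) (at \<theta>)" for \<theta> :: real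
    by (auto intro!: derivative_eq_intros)
  from int[OF this] show "((\<lambda>t. c t ^ 2 * s t) has_integral 0) I"
    unfolding c_def s_def I_def by simp
  have "((\<lambda>\<theta>. sin \<theta> ^ 3 / 3) has_real_derivative cos \<theta> * sin \<theta> ^ 2) (at \<theta>)" for \<theta> :: real
    by (auto intro!: derivative_eq_intros)
  from int[OF this] show "((\<lambda>t. c t * s t ^ 2) has_integral 0) I"
    unfolding c_def s_def I_def by simp
  have "((\<lambda>\<theta>. - (cos \<theta> ^ 4) / 4) has_real_derivative cos \<theta> ^ 3 * sin \<theta>) (at \<theta>)" for \<theta> :: real
    by (auto intro!: derivative_eq_intros)
  from int[OF this] show "((\<lambda>t. c t ^ 3 * s t) has_integral 0) I"
    unfolding c_def s_def I_def by simp
  have "((\<lambda>\<theta>. sin \<theta> ^ 4 / 4) has_real_derivative cos \<theta> * sin \<theta> ^ 3) (at \<theta>)" for \<theta> :: real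
    by (auto intro!: derivative_eq_intros)
  from int[OF this] show "((\<lambda>t. c t * s t ^ 3) has_integral 0) I"
    unfolding c_def s_def I_def by simp
  show "((\<lambda>t. c t ^ 2 * s t ^ 2) has_integral pi / (4 * \<omega>)) I"
    using int[OF q] unfolding c_def s_def I_def by simp
  have "((\<lambda>\<theta>. \<theta> / 2 + sin \<theta> * cos \<theta> / 2 - ?q \<theta>) has_real_derivative cos \<theta> ^ 4) (at \<theta>)" for \<theta>
  proof (rule DERIV_cong[OF DERIV_diff[OF DERIV_add[OF DERIV_cdivide[OF DERIV_ident] dsc] q]])
    have val: "cos \<theta> ^ 2 - sin \<theta> ^ 2 = 2 * (cos \<theta> ^ 4 + cos \<theta> ^ 2 * sin \<theta> ^ 2) - 1"
      using unit[of \<theta>] by algebra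
    show "1 / 2 + (cos \<theta> ^ 2 - sin \<theta> ^ 2) / 2 - cos \<theta> ^ 2 * sin \<theta> ^ 2 = cos \<theta> ^ 4"
      unfolding val by (simp add: diff_divide_distrib add_divide_distrib)
  qed
  from int[OF this] show "((\<lambda>t. c t ^ 4) has_integral 3 * pi / (4 * \<omega>)) I"
    unfolding c_def I_def by (simp add: field_simps)
  have "((\<lambda>\<theta>. \<theta> / 2 - sin \<theta> * cos \<theta> / 2 - ?q \<theta>) has_real_derivative sin \<theta> ^ 4) (at \<theta>)" for \<theta>
  proof (rule DERIV_cong[OF DERIV_diff[OF DERIV_diff[OF DERIV_cdivide[OF DERIV_ident] dsc] q]])
    have val: "cos \<theta> ^ 2 - sin \<theta> ^ 2 = 1 - 2 * (sin \<theta> ^ 4 + cos \<theta> ^ 2 * sin \<theta> ^ 2)"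
      using unit[of \<theta>] by algebra
    show "1 / 2 - (cos \<theta> ^ 2 - sin \<theta> ^ 2) / 2 - cos \<theta> ^ 2 * sin \<theta> ^ 2 = sin \<theta> ^ 4"
      unfolding val by (simp add: diff_divide_distrib add_divide_distrib)
  qed
  from int[OF this] show "((\<lambda>t. s t ^ 4) has_integral 3 * pi / (4 * \<omega>)) I"
    unfolding s_def I_def by (simp add: field_simps)
qed

text \<open>At an equilibrium nothing depends on the slow time, so the mixed derivative drops out.\<close>

lemma order_one_rhs_steady:
  "order_one_rhs \<omega> \<alpha> g (order_zero_solution \<omega> (\<lambda>_. A) (\<lambda>_. \<psi>)) T0 T1 =
     g T0 - cos (\<omega> * T0) * (A * cos (\<omega> * T0 + \<psi>)) - \<alpha> * (A * cos (\<omega> * T0 + \<psi>)) ^ 3"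
  by (simp add: order_one_rhs_def order_zero_solution_def D0_def D1_def)

text \<open>
  The term \<open>cos (\<omega> t) x\<close> leads to moments of degree three only, all of which vanish.  In the cubic term the even
  moments of degree four, \<open>3/4\<close> and \<open>1/4\<close> in units of \<open>pi / \<omega>\<close>, combine to the factor \<open>3/4 (p\<^sup>2 + q\<^sup>2)\<close>.
\<close>

lemma first_harmonic_of_cubic:
  fixes \<omega> \<alpha> p q :: real
  assumes "\<omega> > 0" and gc: "(\<lambda>t. g t * cos (\<omega> * t)) integrable_on {0..2 * pi / \<omega>}"
    and gs: "(\<lambda>t. g t * sin (\<omega> * t)) integrable_on {0..2 * pi / \<omega>}"
  defines "x \<equiv> \<lambda>t. p * cos (\<omega> * t) + q * sin (\<omega> * t)"
  defines "F \<equiv> \<lambda>t. g t - cos (\<omega> * t) * x t - \<alpha> * x t ^ 3"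
  shows "fourier_cos_coeff \<omega> F 1 = fourier_cos_coeff \<omega> g 1 - 3 / 4 * \<alpha> * p * (p\<^sup>2 + q\<^sup>2)"
    and "fourier_sin_coeff \<omega> F 1 = fourier_sin_coeff \<omega> g 1 - 3 / 4 * \<alpha> * q * (p\<^sup>2 + q\<^sup>2)"
proof -
  let ?c = "\<lambda>t. cos (\<omega> * t)" and ?s = "\<lambda>t. sin (\<omega> * t)" and ?I = "{0..2 * pi / \<omega>}"
  note m = trig_moments_over_period[OF \<open>\<omega> > 0\<close>]
  note intros = has_integral_diff has_integral_add has_integral_mult_right integrable_integral gc gs m
  have "((\<lambda>t. g t * ?c t - (p * ?c t ^ 3 + q * (?c t ^ 2 * ?s t)) - \<alpha> * (p ^ 3 * ?c t ^ 4
       + 3 * p\<^sup>2 * q * (?c t ^ 3 * ?s t) + 3 * p * q\<^sup>2 * (?c t ^ 2 * ?s t ^ 2) + q ^ 3 * (?c t * ?s t ^ 3)))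
    has_integral integral ?I (\<lambda>t. g t * ?c t) - (p * 0 + q * 0) - \<alpha> * (p ^ 3 * (3 * pi / (4 * \<omega>))
       + 3 * p\<^sup>2 * q * 0 + 3 * p * q\<^sup>2 * (pi / (4 * \<omega>)) + q ^ 3 * 0)) ?I"
    by (intro intros)
  moreover have "g t * ?c t - (p * ?c t ^ 3 + q * (?c t ^ 2 * ?s t)) - \<alpha> * (p ^ 3 * ?c t ^ 4
       + 3 * p\<^sup>2 * q * (?c t ^ 3 * ?s t) + 3 * p * q\<^sup>2 * (?c t ^ 2 * ?s t ^ 2) + q ^ 3 * (?c t * ?s t ^ 3))
     = F t * ?c t" for t
    unfolding F_def x_def by algebra
  ultimately have "integral ?I (\<lambda>t. F t * ?c t) = integral ?I (\<lambda>t. g t * ?c t)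
      - \<alpha> * (p ^ 3 * (3 * pi / (4 * \<omega>)) + 3 * p * q\<^sup>2 * (pi / (4 * \<omega>)))"
    by (simp add: integral_unique)
  then show "fourier_cos_coeff \<omega> F 1 = fourier_cos_coeff \<omega> g 1 - 3 / 4 * \<alpha> * p * (p\<^sup>2 + q\<^sup>2)"
    using \<open>\<omega> > 0\<close> by (simp add: fourier_cos_coeff_def) (simp add: field_simps power2_eq_square power3_eq_cube)
  have "((\<lambda>t. g t * ?s t - (p * (?c t ^ 2 * ?s t) + q * (?c t * ?s t ^ 2)) - \<alpha> * (p ^ 3 * (?c t ^ 3 * ?s t)
       + 3 * p\<^sup>2 * q * (?c t ^ 2 * ?s t ^ 2) + 3 * p * q\<^sup>2 * (?c t * ?s t ^ 3) + q ^ 3 * ?s t ^ 4))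
    has_integral integral ?I (\<lambda>t. g t * ?s t) - (p * 0 + q * 0) - \<alpha> * (p ^ 3 * 0
       + 3 * p\<^sup>2 * q * (pi / (4 * \<omega>)) + 3 * p * q\<^sup>2 * 0 + q ^ 3 * (3 * pi / (4 * \<omega>)))) ?I"
    by (intro intros)
  moreover have "g t * ?s t - (p * (?c t ^ 2 * ?s t) + q * (?c t * ?s t ^ 2)) - \<alpha> * (p ^ 3 * (?c t ^ 3 * ?s t)
       + 3 * p\<^sup>2 * q * (?c t ^ 2 * ?s t ^ 2) + 3 * p * q\<^sup>2 * (?c t * ?s t ^ 3) + q ^ 3 * ?s t ^ 4)
     = F t * ?s t" for t
    unfolding F_def x_def by algebra
  ultimately have "integral ?I (\<lambda>t. F t * ?s t) = integral ?I (\<lambda>t. g t * ?s t)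
      - \<alpha> * (3 * p\<^sup>2 * q * (pi / (4 * \<omega>)) + q ^ 3 * (3 * pi / (4 * \<omega>)))"
    by (simp add: integral_unique)
  then show "fourier_sin_coeff \<omega> F 1 = fourier_sin_coeff \<omega> g 1 - 3 / 4 * \<alpha> * q * (p\<^sup>2 + q\<^sup>2)"
    using \<open>\<omega> > 0\<close> by (simp add: fourier_sin_coeff_def) (simp add: field_simps power2_eq_square power3_eq_cube)
qed

text \<open>
  With \<open>r = p\<^sup>2 + q\<^sup>2\<close> the two equations give \<open>a\<^sup>2 + b\<^sup>2 = 9/16 \<alpha>\<^sup>2 r\<^sup>3\<close>, which eliminates \<open>r\<close> from
  \<open>a\<^sup>3 = (3/4 \<alpha> r)\<^sup>3 p\<^sup>3\<close>.  Conversely the cube roots are \<open>k a\<close> and \<open>k b\<close> with a common factor \<open>k\<close>.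
\<close>

lemma cubic_system_unique_solution:
  fixes a b p q \<alpha> :: real
  assumes "\<alpha> \<noteq> 0" and ab: "\<not> (a = 0 \<and> b = 0)"
  shows "a = 3 / 4 * \<alpha> * p * (p\<^sup>2 + q\<^sup>2) \<and> b = 3 / 4 * \<alpha> * q * (p\<^sup>2 + q\<^sup>2) \<longleftrightarrow>
     p = root 3 (4 * a ^ 3 / (3 * \<alpha> * (a\<^sup>2 + b\<^sup>2))) \<and> q = root 3 (4 * b ^ 3 / (3 * \<alpha> * (a\<^sup>2 + b\<^sup>2)))"
    (is "?L \<longleftrightarrow> ?R")
proof
  assume L: ?L
  define r where "r = p\<^sup>2 + q\<^sup>2"
  have ar: "a = 3 / 4 * \<alpha> * p * r" and br: "b = 3 / 4 * \<alpha> * q * r"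
    using L by (simp_all add: r_def)
  have "r \<noteq> 0" using ar br ab by auto
  have "a\<^sup>2 + b\<^sup>2 = 9 / 16 * \<alpha>\<^sup>2 * r\<^sup>2 * (p\<^sup>2 + q\<^sup>2)"
    unfolding ar br by (simp add: power_mult_distrib power_divide algebra_simps)
  then have "a\<^sup>2 + b\<^sup>2 = 9 / 16 * \<alpha>\<^sup>2 * r ^ 3"
    unfolding r_def[symmetric] by (simp add: power2_eq_square power3_eq_cube)
  then have D: "3 * \<alpha> * (a\<^sup>2 + b\<^sup>2) = 27 / 16 * \<alpha> ^ 3 * r ^ 3"
    by (simp add: power2_eq_square power3_eq_cube)
  have cube: "4 * (3 / 4 * \<alpha> * x * r) ^ 3 / (27 / 16 * \<alpha> ^ 3 * r ^ 3) = x ^ 3" for x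
    using \<open>r \<noteq> 0\<close> \<open>\<alpha> \<noteq> 0\<close> by (simp add: field_simps power3_eq_cube)
  have "root 3 (x ^ 3) = x" for x :: real
    by (rule odd_real_root_power_cancel) simp
  then show ?R
    unfolding D unfolding ar br cube by simp
next
  assume R: ?R
  define k where "k = root 3 (4 / (3 * \<alpha> * (a\<^sup>2 + b\<^sup>2)))"
  have pos: "a\<^sup>2 + b\<^sup>2 \<noteq> 0" using ab by (simp add: sum_power2_eq_zero_iff)
  have k3: "k ^ 3 = 4 / (3 * \<alpha> * (a\<^sup>2 + b\<^sup>2))"
    unfolding k_def by (rule odd_real_root_pow) simp
  have mult: "root 3 (4 * x ^ 3 / (3 * \<alpha> * (a\<^sup>2 + b\<^sup>2))) = x * k" for x
  proof -
    have "4 * x ^ 3 / (3 * \<alpha> * (a\<^sup>2 + b\<^sup>2)) = (x * k) ^ 3"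
      by (simp add: power_mult_distrib k3)
    then show ?thesis by (simp add: odd_real_root_power_cancel)
  qed
  have pq: "p = a * k" "q = b * k" using R by (simp_all only: mult)
  have "3 / 4 * \<alpha> * (x * k) * (p\<^sup>2 + q\<^sup>2) = x" for x
  proof -
    have "3 / 4 * \<alpha> * (x * k) * (p\<^sup>2 + q\<^sup>2) = 3 / 4 * \<alpha> * x * k ^ 3 * (a\<^sup>2 + b\<^sup>2)"
      unfolding pq by (simp add: power2_eq_square power3_eq_cube algebra_simps)
    also have "\<dots> = x"
      unfolding k3 using pos \<open>\<alpha> \<noteq> 0\<close> by simp
    finally show ?thesis .
  qed
  from this[of a] this[of b] show ?L
    by (simp only: flip: pq)
qed

section \<open>The approximate periodic solution\<close>

text \<open>
  The terms of order zero cancel because \<open>x0\<close> is a free oscillation, those of order one by the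
  equation for \<open>y\<close>.  What remains has a factor \<open>\<epsilon>\<^sup>2\<close>, and its cofactor \<open>R\<close> is bounded for
  \<open>\<bar>\<epsilon>\<bar> \<le> 1\<close>.
\<close>

lemma two_term_expansion_residual:
  fixes \<omega> \<alpha> A \<psi> :: real and g y u :: "real \<Rightarrow> real"
  defines "x0 \<equiv> \<lambda>t. A * cos (\<omega> * t + \<psi>)"
  assumes y: "\<And>t. (y has_real_derivative u t) (at t)"
    and u: "\<And>t. isCont g t \<Longrightarrow>
      (u has_real_derivative g t - cos (\<omega> * t) * x0 t - \<alpha> * x0 t ^ 3 - \<omega>\<^sup>2 * y t) (at t)"
    and M: "M \<ge> 0" "\<And>t. \<bar>y t\<bar> \<le> M"
  shows "\<exists>C. \<forall>\<^sub>F \<epsilon> in at 0. \<forall>t. isCont g t \<longrightarrow>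
    \<bar>ode_residual \<omega> \<alpha> g \<epsilon> (\<lambda>t. x0 t + \<epsilon> * y t) t\<bar> \<le> C * \<epsilon>\<^sup>2"
proof -
  define R where "R \<epsilon> t = cos (\<omega> * t) * y t + \<alpha> * (3 * x0 t ^ 2 * y t + 3 * \<epsilon> * x0 t * y t ^ 2 + \<epsilon>\<^sup>2 * y t ^ 3)" for \<epsilon> t
  have res: "ode_residual \<omega> \<alpha> g \<epsilon> (\<lambda>t. x0 t + \<epsilon> * y t) t = \<epsilon>\<^sup>2 * R \<epsilon> t" if "isCont g t" for \<epsilon> t
  proof -
    let ?v = "\<lambda>t. - (A * \<omega> * sin (\<omega> * t + \<psi>)) + \<epsilon> * u t"
    let ?w = "- (\<omega>\<^sup>2 * x0 t) + \<epsilon> * (g t - cos (\<omega> * t) * x0 t - \<alpha> * x0 t ^ 3 - \<omega>\<^sup>2 * y t)"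
    have "((\<lambda>t. x0 t + \<epsilon> * y t) has_real_derivative ?v t) (at t)" for t
      unfolding x0_def by (auto intro!: derivative_eq_intros y)
    then have "deriv (\<lambda>t. x0 t + \<epsilon> * y t) = ?v"
      using DERIV_imp_deriv by blast
    moreover have "(?v has_real_derivative ?w) (at t)"
    proof (rule DERIV_cong)
      show "(?v has_real_derivative - (A * \<omega> * (cos (\<omega> * t + \<psi>) * \<omega>))
          + \<epsilon> * (g t - cos (\<omega> * t) * x0 t - \<alpha> * x0 t ^ 3 - \<omega>\<^sup>2 * y t)) (at t)"
        by (auto intro!: derivative_eq_intros u that)
    qed (simp add: x0_def power2_eq_square)
    ultimately have "deriv (deriv (\<lambda>t. x0 t + \<epsilon> * y t)) t = ?w"
      by (simp add: DERIV_imp_deriv)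
    then show ?thesis
      unfolding ode_residual_def R_def by algebra
  qed
  define C where "C = M + \<bar>\<alpha>\<bar> * (3 * \<bar>A\<bar>\<^sup>2 * M + 3 * \<bar>A\<bar> * M\<^sup>2 + M ^ 3)"
  have bound: "\<bar>R \<epsilon> t\<bar> \<le> C" if "\<bar>\<epsilon>\<bar> \<le> 1" for \<epsilon> t
  proof -
    have x0: "\<bar>x0 t\<bar> \<le> \<bar>A\<bar>"
      unfolding x0_def abs_mult by (rule mult_left_le) auto
    have x0sq: "\<bar>x0 t ^ 2\<bar> \<le> \<bar>A\<bar>\<^sup>2"
      unfolding power_abs by (rule power_mono[OF x0]) simp
    have ypow: "\<bar>y t ^ n\<bar> \<le> M ^ n" for n
      unfolding power_abs by (rule power_mono[OF M(2)]) simp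
    have "\<bar>cos (\<omega> * t) * y t\<bar> \<le> 1 * M"
      unfolding abs_mult by (intro mult_mono M abs_cos_le_one) auto
    moreover have "\<bar>3 * x0 t ^ 2 * y t\<bar> \<le> 3 * \<bar>A\<bar>\<^sup>2 * M"
      unfolding abs_mult using \<open>M \<ge> 0\<close> by (intro mult_mono M x0sq) auto
    moreover have "\<bar>3 * \<epsilon> * x0 t * y t ^ 2\<bar> \<le> 3 * 1 * \<bar>A\<bar> * M\<^sup>2"
      unfolding abs_mult using \<open>M \<ge> 0\<close> by (intro mult_mono x0 ypow that) auto
    moreover have "\<bar>\<epsilon>\<^sup>2 * y t ^ 3\<bar> \<le> 1 * M ^ 3"
      unfolding abs_mult using \<open>M \<ge> 0\<close> that by (intro mult_mono ypow) (auto simp: abs_square_le_1)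
    ultimately have 1: "\<bar>cos (\<omega> * t) * y t\<bar> \<le> M"
      and 2: "\<bar>3 * x0 t ^ 2 * y t + 3 * \<epsilon> * x0 t * y t ^ 2 + \<epsilon>\<^sup>2 * y t ^ 3\<bar>
        \<le> 3 * \<bar>A\<bar>\<^sup>2 * M + 3 * \<bar>A\<bar> * M\<^sup>2 + M ^ 3"
      by auto
    have "\<bar>\<alpha> * (3 * x0 t ^ 2 * y t + 3 * \<epsilon> * x0 t * y t ^ 2 + \<epsilon>\<^sup>2 * y t ^ 3)\<bar>
        \<le> \<bar>\<alpha>\<bar> * (3 * \<bar>A\<bar>\<^sup>2 * M + 3 * \<bar>A\<bar> * M\<^sup>2 + M ^ 3)"
      unfolding abs_mult[of \<alpha>] by (rule mult_left_mono[OF 2]) simp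
    with 1 show ?thesis
      unfolding R_def C_def by linarith
  qed
  have "\<forall>\<^sub>F \<epsilon> in at 0. \<bar>\<epsilon>\<bar> \<le> (1::real)"
    unfolding eventually_at by (intro exI[of _ 1]) auto
  then have "\<forall>\<^sub>F \<epsilon> in at 0. \<forall>t. isCont g t \<longrightarrow>
    \<bar>ode_residual \<omega> \<alpha> g \<epsilon> (\<lambda>t. x0 t + \<epsilon> * y t) t\<bar> \<le> C * \<epsilon>\<^sup>2"
  proof eventually_elim
    case (elim \<epsilon>)
    show ?case
    proof (intro allI impI)
      fix t assume "isCont g t"
      then have "\<bar>ode_residual \<omega> \<alpha> g \<epsilon> (\<lambda>t. x0 t + \<epsilon> * y t) t\<bar> = \<bar>R \<epsilon> t\<bar> * \<epsilon>\<^sup>2"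
        by (simp add: res abs_mult)
      also have "\<dots> \<le> C * \<epsilon>\<^sup>2"
        by (intro mult_right_mono bound elim) auto
      finally show "\<bar>ode_residual \<omega> \<alpha> g \<epsilon> (\<lambda>t. x0 t + \<epsilon> * y t) t\<bar> \<le> C * \<epsilon>\<^sup>2" .
    qed
  qed
  then show ?thesis by blast
qed

lemma trig_series_periodic:
  assumes "\<omega> \<noteq> 0"
  shows "trig_series \<omega> a b (t + 2 * pi / \<omega>) = trig_series \<omega> a b t"
proof -
  have arg: "real n * \<omega> * (t + 2 * pi / \<omega>) = real n * \<omega> * t + 2 * real n * pi" for n
    using assms by (simp add: field_simps)
  have "cos (real n * \<omega> * (t + 2 * pi / \<omega>)) = cos (real n * \<omega> * t)"
    "sin (real n * \<omega> * (t + 2 * pi / \<omega>)) = sin (real n * \<omega> * t)" for n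
    unfolding arg by (simp_all only: cos_add sin_add cos_2npi sin_2npi)
  then show ?thesis
    by (simp only: trig_series_def)
qed

theorem theorem2:
  fixes \<omega> \<alpha> :: real and f :: "real \<Rightarrow> real" and a b :: "nat \<Rightarrow> real"
    and xs ys :: real and z :: "real \<Rightarrow> real"
  assumes "\<omega> > 0" and "\<alpha> \<noteq> 0"
    and "\<forall>t. f (t + 2 * pi / \<omega>) = f t"
    and "dirichlet_conditions (2 * pi / \<omega>) f"
    and "integral {0..2 * pi / \<omega>} f = 0"
    and "a = fourier_cos_coeff \<omega> f" and "b = fourier_sin_coeff \<omega> f"
    and "\<not> (a 1 = 0 \<and> b 1 = 0)"
    and "xs = root 3 (4 * a 1 ^ 3 / (3 * \<alpha> * ((a 1)\<^sup>2 + (b 1)\<^sup>2)))"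
    and "ys = root 3 (4 * b 1 ^ 3 * \<omega> ^ 3 / (3 * \<alpha> * ((a 1)\<^sup>2 + (b 1)\<^sup>2)))"
    and "z = (\<lambda>t. (\<omega> * xs * cos (\<omega> * t) + ys * sin (\<omega> * t)) / \<omega>)"
  shows "(\<exists>x0 x. approx_periodic_solution \<omega> \<alpha> (trig_series \<omega> a b) x0 x \<and>
            (\<forall>\<epsilon> t. x \<epsilon> (t + 2 * pi / \<omega>) = x \<epsilon> t)) \<and>
         (\<forall>x0 x. approx_periodic_solution \<omega> \<alpha> (trig_series \<omega> a b) x0 x \<longrightarrow>
            x0 = z \<and> (\<exists>C. \<forall>\<^sub>F \<epsilon> in at 0. \<forall>t. \<bar>x \<epsilon> t - z t\<bar> \<le> C * \<bar>\<epsilon>\<bar>))"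
proof -
  define T where "T = 2 * pi / \<omega>"
  define g where "g = trig_series \<omega> a b"
  have "T > 0" using \<open>\<omega> > 0\<close> by (simp add: T_def)
  have f_per: "f (t + T) = f t" for t using assms(3) by (simp add: T_def)
  have g_per: "g (t + T) = g t" for t
    using \<open>\<omega> > 0\<close> by (simp add: g_def T_def trig_series_periodic)
  have dir: "dirichlet_conditions T f" using assms(4) by (simp add: T_def)
  have f_fin: "finite {t \<in> {c..d}. \<not> isCont f t}" for c d
    using finite_discontinuities_on_intervals[where f = f, OF \<open>T > 0\<close> f_per] dir
    by (auto simp: dirichlet_conditions_def)
  \<comment> \<open>at the jumps of \<open>f\<close> nothing is claimed about \<open>g\<close>: finitely many points per period do not affect integrals\<close>
  have g_eq_f: "g t = f t" if "isCont f t" for t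
    unfolding g_def \<open>a = _\<close> \<open>b = _\<close>
    by (rule trig_series_at_continuity_point[OF \<open>\<omega> > 0\<close> _ assms(4,5) that]) (use assms(3) in blast)
  have g_cont: "isCont g t" if "isCont f t" for t
  proof -
    have "\<forall>\<^sub>F s in at t. isCont f s"
      by (rule eventually_isCont_if_finite_discontinuities[OF f_fin])
    with that have "\<forall>\<^sub>F s in nhds t. g s = f s"
      by (auto simp: eventually_nhds_conv_at g_eq_f elim!: eventually_mono)
    then show ?thesis using that isCont_cong by blast
  qed
  have g_fin: "finite {t \<in> {c..d}. \<not> isCont g t}" for c d
    by (rule finite_subset[OF _ f_fin[of c d]]) (use g_cont in auto)
  have f_int: "(\<lambda>t. f t * K t) integrable_on {c..d}" if "continuous_on UNIV K" for K c d
  proof (rule piecewise_monotone_mult_integrable)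
    show "piecewise_monotone f"
      by (rule dirichlet_conditions_piecewise_monotone[where f = f, OF \<open>T > 0\<close> f_per dir])
    show "bounded (range f)"
      using bounded_range_periodic[where f = f, OF \<open>T > 0\<close> f_per] dir
      by (auto simp: dirichlet_conditions_def)
  qed (intro integrable_continuous_real continuous_on_subset[OF that] subset_UNIV)
  have g_int: "(\<lambda>t. g t * K t) integrable_on {c..d}" if "continuous_on UNIV K" for K c d
    by (rule integrable_spike_finite[OF f_fin[of c d] _ f_int[OF that]]) (auto simp: g_eq_f)
  have "integral {0..2 * pi / \<omega>} (\<lambda>t. g t * K t) = integral {0..2 * pi / \<omega>} (\<lambda>t. f t * K t)" for K
    by (rule integral_spike[OF negligible_finite[OF f_fin[of 0 "2 * pi / \<omega>"]]]) (auto simp: g_eq_f)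
  then have coeff: "fourier_cos_coeff \<omega> g n = fourier_cos_coeff \<omega> f n"
    "fourier_sin_coeff \<omega> g n = fourier_sin_coeff \<omega> f n" for n
    by (simp_all add: fourier_cos_coeff_def fourier_sin_coeff_def)
  define S where "S = root 3 (4 * b 1 ^ 3 / (3 * \<alpha> * ((a 1)\<^sup>2 + (b 1)\<^sup>2)))"
  \<comment> \<open>the factor \<open>\<omega>\<^sup>3\<close> under the root compensates the division by \<open>\<omega>\<close> in \<open>z\<close>\<close>
  have ys: "ys = \<omega> * S"
  proof -
    have "4 * b 1 ^ 3 * \<omega> ^ 3 / (3 * \<alpha> * ((a 1)\<^sup>2 + (b 1)\<^sup>2))
        = \<omega> ^ 3 * (4 * b 1 ^ 3 / (3 * \<alpha> * ((a 1)\<^sup>2 + (b 1)\<^sup>2)))"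
      by simp
    moreover have "root 3 (\<omega> ^ 3) = \<omega>"
      by (rule odd_real_root_power_cancel) simp
    ultimately show ?thesis
      unfolding \<open>ys = _\<close> S_def by (simp only: real_root_mult)
  qed
  have z: "z = (\<lambda>t. xs * cos (\<omega> * t) + S * sin (\<omega> * t))"
    unfolding \<open>z = _\<close> ys using \<open>\<omega> > 0\<close> by (simp add: add_divide_distrib)
  have x0_expand: "A * cos (\<omega> * t + \<psi>) = (A * cos \<psi>) * cos (\<omega> * t) + (- (A * sin \<psi>)) * sin (\<omega> * t)" for A \<psi> t
    by (simp add: cos_add algebra_simps)
  \<comment> \<open>the right-hand side of the first-order equation at a candidate equilibrium\<close>
  define F where "F A \<psi> t = g t - cos (\<omega> * t) * (A * cos (\<omega> * t + \<psi>)) - \<alpha> * (A * cos (\<omega> * t + \<psi>)) ^ 3" for A \<psi> t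
  \<comment> \<open>the phase form \<open>A cos (\<omega> t + \<psi>)\<close> has cosine component \<open>A cos \<psi>\<close> and sine component \<open>- A sin \<psi>\<close>\<close>
  have secular: "no_secular_terms \<omega> (F A \<psi>) \<longleftrightarrow> A * cos \<psi> = xs \<and> - (A * sin \<psi>) = S" for A \<psi>
  proof -
    let ?p = "A * cos \<psi>" and ?q = "- (A * sin \<psi>)"
    have int: "(\<lambda>t. g t * cos (\<omega> * t)) integrable_on {0..2 * pi / \<omega>}"
      "(\<lambda>t. g t * sin (\<omega> * t)) integrable_on {0..2 * pi / \<omega>}"
      by (intro g_int continuous_intros)+
    have F_eq: "F A \<psi> = (\<lambda>t. g t - cos (\<omega> * t) * (?p * cos (\<omega> * t) + ?q * sin (\<omega> * t))
        - \<alpha> * (?p * cos (\<omega> * t) + ?q * sin (\<omega> * t)) ^ 3)"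
      unfolding F_def x0_expand ..
    have "fourier_cos_coeff \<omega> (F A \<psi>) 1 = a 1 - 3 / 4 * \<alpha> * ?p * (?p\<^sup>2 + ?q\<^sup>2)"
      "fourier_sin_coeff \<omega> (F A \<psi>) 1 = b 1 - 3 / 4 * \<alpha> * ?q * (?p\<^sup>2 + ?q\<^sup>2)"
      unfolding F_eq first_harmonic_of_cubic[OF \<open>\<omega> > 0\<close> int] coeff \<open>a = _\<close> \<open>b = _\<close> by (rule refl)+
    then have "no_secular_terms \<omega> (F A \<psi>) \<longleftrightarrow>
        a 1 = 3 / 4 * \<alpha> * ?p * (?p\<^sup>2 + ?q\<^sup>2) \<and> b 1 = 3 / 4 * \<alpha> * ?q * (?p\<^sup>2 + ?q\<^sup>2)"
      unfolding no_secular_terms_def by (simp only: right_minus_eq)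
    also have "\<dots> \<longleftrightarrow> ?p = xs \<and> ?q = S"
      unfolding \<open>xs = _\<close> S_def by (rule cubic_system_unique_solution[OF \<open>\<alpha> \<noteq> 0\<close> assms(8)])
    finally show ?thesis .
  qed
  have equilibrium: "amplitude_phase_equilibrium \<omega> \<alpha> g A \<psi> \<longleftrightarrow> A * cos \<psi> = xs \<and> - (A * sin \<psi>) = S" for A \<psi>
    unfolding secular[symmetric]
    by (simp add: amplitude_phase_equilibrium_def amplitude_phase_equations_def order_one_rhs_steady
        F_def[abs_def])
  have "\<exists>x0 x. approx_periodic_solution \<omega> \<alpha> g x0 x \<and> (\<forall>\<epsilon> t. x \<epsilon> (t + 2 * pi / \<omega>) = x \<epsilon> t)"
  proof -
    obtain A \<psi>' where pol: "xs = A * cos \<psi>'" "S = A * sin \<psi>'"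
      using polar_Ex by blast
    \<comment> \<open>polar coordinates of \<open>(xs, S)\<close>, with the phase reversed because the sine component is \<open>- A sin \<psi>\<close>\<close>
    define \<psi> where "\<psi> = - \<psi>'"
    have eq: "A * cos \<psi> = xs \<and> - (A * sin \<psi>) = S"
      using pol by (simp add: \<psi>_def)
    let ?x0 = "\<lambda>t. A * cos (\<omega> * t + \<psi>)"
    have x0_per: "?x0 (t + 2 * pi / \<omega>) = ?x0 t" for t
    proof -
      have "\<omega> * (t + 2 * pi / \<omega>) + \<psi> = (\<omega> * t + \<psi>) + 2 * pi"
        using \<open>\<omega> > 0\<close> by (simp add: field_simps)
      then show ?thesis by (simp only: cos_periodic)
    qed
    have F_int: "(\<lambda>s. F A \<psi> s * K s) integrable_on {c..d}" if K: "continuous_on UNIV K" for K c d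
    proof -
      have "(\<lambda>s. g s * K s - (cos (\<omega> * s) * ?x0 s + \<alpha> * ?x0 s ^ 3) * K s) integrable_on {c..d}"
        by (intro integrable_diff g_int K integrable_continuous_real continuous_intros
            continuous_on_subset[OF K] subset_UNIV)
      then show ?thesis
        by (simp add: F_def algebra_simps)
    qed
    have F_per: "F A \<psi> (t + 2 * pi / \<omega>) = F A \<psi> t" for t
    proof -
      have "cos (\<omega> * (t + 2 * pi / \<omega>)) = cos (\<omega> * t)"
        using \<open>\<omega> > 0\<close> by (simp add: distrib_left)
      then show ?thesis
        unfolding F_def x0_per using g_per[of t] by (simp add: T_def)
    qed
    have F_cont: "isCont (F A \<psi>) t" if "isCont g t" for t
      unfolding F_def[abs_def] using that by (intro continuous_intros) auto
    have F_fin: "finite {t \<in> {c..d}. \<not> isCont (F A \<psi>) t}" for c d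
      by (rule finite_subset[OF _ g_fin[of c d]]) (use F_cont in auto)
    obtain y u where y_per: "\<And>t. y (t + 2 * pi / \<omega>) = y t"
      and y: "\<And>t. (y has_real_derivative u t) (at t)" and u_cont: "continuous_on UNIV u"
      and u: "\<And>t. isCont (F A \<psi>) t \<Longrightarrow> (u has_real_derivative F A \<psi> t - \<omega>\<^sup>2 * y t) (at t)"
    proof (rule nonresonant_oscillator_periodic_solution[OF \<open>\<omega> > 0\<close>, of "F A \<psi>"])
      show "no_secular_terms \<omega> (F A \<psi>)" using eq by (simp only: secular)
    qed (use F_per F_fin in \<open>auto intro!: F_int continuous_intros\<close>)
    have deriv_y: "deriv y = u" using y DERIV_imp_deriv by blast
    have "continuous_on UNIV y"
      using y by (intro continuous_at_imp_continuous_on) (auto intro: DERIV_isCont)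
    then obtain M where "M \<ge> 0" "\<And>t. \<bar>y t\<bar> \<le> M"
      using continuous_periodic_bounded[where y = y, OF \<open>T > 0\<close>] y_per unfolding T_def by blast
    then have "\<exists>C. \<forall>\<^sub>F \<epsilon> in at 0. \<forall>t. isCont g t \<longrightarrow>
        \<bar>ode_residual \<omega> \<alpha> g \<epsilon> (\<lambda>t. ?x0 t + \<epsilon> * y t) t\<bar> \<le> C * \<epsilon>\<^sup>2"
      using u F_cont by (intro two_term_expansion_residual[OF y]) (auto simp: F_def)
    then obtain C where res: "\<forall>\<^sub>F \<epsilon> in at 0. \<forall>t. isCont g t \<longrightarrow>
        \<bar>ode_residual \<omega> \<alpha> g \<epsilon> (\<lambda>t. ?x0 t + \<epsilon> * y t) t\<bar> \<le> C * \<epsilon>\<^sup>2" ..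
    have "approx_periodic_solution \<omega> \<alpha> g ?x0 (\<lambda>\<epsilon> t. ?x0 t + \<epsilon> * y t)"
      unfolding approx_periodic_solution_def
    proof (intro exI conjI)
      show "amplitude_phase_equilibrium \<omega> \<alpha> g A \<psi>" using eq by (simp only: equilibrium)
      show "\<forall>t. y differentiable (at t)"
        using y real_differentiable_def by blast
      show "continuous_on UNIV (deriv y)" unfolding deriv_y by (fact u_cont)
      show "\<forall>t. isCont g t \<longrightarrow> deriv y differentiable (at t)"
        unfolding deriv_y using u F_cont real_differentiable_def by blast
    qed (use y_per res in blast)+
    moreover have "\<forall>\<epsilon> t. ?x0 (t + 2 * pi / \<omega>) + \<epsilon> * y (t + 2 * pi / \<omega>) = ?x0 t + \<epsilon> * y t"
      unfolding x0_per y_per by simp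
    ultimately show ?thesis by blast
  qed
  moreover have "x0 = z \<and> (\<exists>C. \<forall>\<^sub>F \<epsilon> in at 0. \<forall>t. \<bar>x \<epsilon> t - z t\<bar> \<le> C * \<bar>\<epsilon>\<bar>)"
    if sol: "approx_periodic_solution \<omega> \<alpha> g x0 x" for x0 x
  proof -
    obtain A \<psi> y where eq: "A * cos \<psi> = xs" "- (A * sin \<psi>) = S"
      and x0: "x0 = (\<lambda>t. A * cos (\<omega> * t + \<psi>))" and x: "x = (\<lambda>\<epsilon> t. x0 t + \<epsilon> * y t)"
      and y: "\<And>t. y (t + 2 * pi / \<omega>) = y t" "\<And>t. y differentiable (at t)"
      using sol unfolding approx_periodic_solution_def equilibrium by blast
    have "x0 = z"
      unfolding x0 z x0_expand eq ..
    have "continuous_on UNIV y"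
      using y(2) by (intro continuous_at_imp_continuous_on) (auto intro: differentiable_imp_continuous_within)
    then obtain M where M: "\<And>t. \<bar>y t\<bar> \<le> M"
      using continuous_periodic_bounded[where y = y, OF \<open>T > 0\<close>] y(1) unfolding T_def by blast
    have "\<bar>x \<epsilon> t - z t\<bar> \<le> M * \<bar>\<epsilon>\<bar>" for \<epsilon> t
      unfolding x \<open>x0 = z\<close> using mult_right_mono[OF M[of t] abs_ge_zero[of \<epsilon>]]
      by (simp add: abs_mult mult.commute)
    with \<open>x0 = z\<close> show ?thesis
      by (intro conjI exI[of _ M] always_eventually) auto
  qed
  ultimately show ?thesis
    unfolding g_def by blast
qed

end
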